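(* Let $\mathcal{X}=\{0,1,\dots,|\mathcal{X}|-1\}$ be a finite alphabet. The capacity region of the modulo-additive state-dependent Z-interference channel over $\mathcal{X}$ with state $S$ i.i.d. $\mathrm{Ber}(\lambda)$ known noncausally at encoder 1 only (defined in the context) is given by the convex closure of the rate pairs $(R_1,R_2)$ satisfying $$\begin{aligned} R_1 & < (1-\lambda)\log |\mathcal{X}| + \lambda H(\boldsymbol{p}),\\ R_2 & < \log |\mathcal{X}| - H\left(\lambda \boldsymbol{p} + (1-\lambda)\boldsymbol{\delta}_0\right), \end{aligned}$$ for some $\boldsymbol{p}\in\mathcal{P}_{\mathcal{X}}$, where $\mathcal{P}_{\mathcal{X}}$ denotes the probability simplex corresponding to $\mathcal{X}$ (the set of pmfs on $\mathcal{X}$), $H(\boldsymbol{p})$ stands for the entropy of the pmf $\boldsymbol{p}$, and $\boldsymbol{\delta}_0$ denotes the pmf that has unit mass at $0$.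
   Context: Channel: all channel inputs $X_1,X_2$ and outputs $Y_1,Y_2$ take values in $\mathcal{X}$; the state $S\in\{0,1\}$ is i.i.d. $\mathrm{Ber}(\lambda)$ (i.e. $\Pr\{S=1\}=\lambda$) over the $n$ channel uses and independent of the messages. In each channel use $$Y_1=X_1,\qquad Y_2=X_2\oplus (S\cdot X_1),$$ where $\oplus$ is addition modulo $|\mathcal{X}|$. So in state $S=0$ there is no interference, and in state $S=1$ the cross-link from transmitter 1 to receiver 2 is present. Codes: logarithms and entropies are in base 2. The messages $M_1,M_2$ are independent and uniform on $[1:2^{nR_1}]$ and $[1:2^{nR_2}]$ respectively, where $[1:2^{nR}]$ denotes the set $\{1,2,\dots,2^{nR}\}$ (with the usual integer rounding); sender $j$ communicates $M_j$ to receiver $j$. An $(n,2^{nR_1},2^{nR_2},\epsilon)$ code consists of encoding functions $f_{1,i}:[1:2^{nR_1}]\times\{0,1\}^n\to\mathcal{X}$ (encoder 1 knows the whole state sequence $S^n$ noncausally) and $f_{2,i}:[1:2^{nR_2}]\to\mathcal{X}$, $1\le i\le n$, and decoding functions $g_j:\mathcal{X}^n\to[1:2^{nR_j}]$ (applied to $Y_j^n$), with $\Pr\{g_j(Y_j^n)\ne M_j\}\le\epsilon$ for $j\in\{1,2\}$. A rate pair $(R_1,R_2)$ is achievable if for every $\epsilon>0$ there exists an $(n,2^{nR_1},2^{nR_2},\epsilon)$ code for sufficiently large $n$. The capacity region is the closure of the set of achievable rate pairs. Rate pairs are pairs of nonnegative reals; "convex closure" means closure of the convex hull.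
   Formalization: The alphabet is assumed to have at least two elements; for $|\mathcal{X}|=1$ the strict bound $R_1<0$ leaves no nonnegative rate pairs, whereas the capacity region is $\{(0,0)\}$. *)

theory Defs
  imports "HOL-Probability.Probability"
begin

text \<open>The alphabet is \<open>{..<q}\<close>. Channel uses are numbered \<open>1..n\<close>, and length-\<open>n\<close> sequences over
  a set \<open>A\<close> are the functions in \<open>{1..n} \<rightarrow>\<^sub>E A\<close> (equal to \<open>undefined\<close> outside \<open>{1..n}\<close>).\<close>

definition state_seqs :: "nat \<Rightarrow> (nat \<Rightarrow> bool) set" where
  "state_seqs n = ({1..n} \<rightarrow>\<^sub>E UNIV)"

definition symbol_seqs :: "nat \<Rightarrow> nat \<Rightarrow> (nat \<Rightarrow> nat) set" where
  "symbol_seqs q n = ({1..n} \<rightarrow>\<^sub>E {..<q})"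

text \<open>The message set \<open>[1:2\<^bsup>nR\<^esup>]\<close>; the integer rounding is down, so it has
  \<open>\<lfloor>2\<^bsup>nR\<^esup>\<rfloor>\<close> elements (at least one when \<open>R \<ge> 0\<close>).\<close>

definition messages :: "nat \<Rightarrow> real \<Rightarrow> nat set" where
  "messages n R = {m. 1 \<le> m \<and> real m \<le> 2 powr (real n * R)}"

definition channel_out1 :: "nat \<Rightarrow> nat" where
  "channel_out1 x1 = x1"

definition channel_out2 :: "nat \<Rightarrow> bool \<Rightarrow> nat \<Rightarrow> nat \<Rightarrow> nat" where
  "channel_out2 q s x1 x2 = (x2 + of_bool s * x1) mod q"

text \<open>Joint distribution of \<open>(M\<^sub>1, M\<^sub>2, S\<^sup>n)\<close>. Taking \<open>undefined\<close> as the default value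
  puts the state sequence in \<open>state_seqs n\<close>.\<close>

definition source_pmf :: "real \<Rightarrow> nat \<Rightarrow> real \<Rightarrow> real \<Rightarrow> (nat \<times> nat \<times> (nat \<Rightarrow> bool)) pmf" where
  "source_pmf lam n R1 R2 =
     pair_pmf (pmf_of_set (messages n R1))
       (pair_pmf (pmf_of_set (messages n R2))
         (Pi_pmf {1..n} undefined (\<lambda>_. bernoulli_pmf lam)))"

text \<open>The encoders take the time index first: \<open>f1 i m1 s\<close> and \<open>f2 i m2\<close> are the symbols sent
  in channel use \<open>i\<close>.\<close>

definition received1 ::
    "nat \<Rightarrow> (nat \<Rightarrow> nat \<Rightarrow> (nat \<Rightarrow> bool) \<Rightarrow> nat) \<Rightarrow> nat \<Rightarrow> (nat \<Rightarrow> bool) \<Rightarrow> nat \<Rightarrow> nat" where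
  "received1 n f1 m1 s = (\<lambda>i\<in>{1..n}. channel_out1 (f1 i m1 s))"

definition received2 ::
    "nat \<Rightarrow> nat \<Rightarrow> (nat \<Rightarrow> nat \<Rightarrow> (nat \<Rightarrow> bool) \<Rightarrow> nat) \<Rightarrow> (nat \<Rightarrow> nat \<Rightarrow> nat)
      \<Rightarrow> nat \<Rightarrow> nat \<Rightarrow> (nat \<Rightarrow> bool) \<Rightarrow> nat \<Rightarrow> nat" where
  "received2 q n f1 f2 m1 m2 s = (\<lambda>i\<in>{1..n}. channel_out2 q (s i) (f1 i m1 s) (f2 i m2))"

definition is_code ::
    "nat \<Rightarrow> real \<Rightarrow> nat \<Rightarrow> real \<Rightarrow> real \<Rightarrow> real
      \<Rightarrow> (nat \<Rightarrow> nat \<Rightarrow> (nat \<Rightarrow> bool) \<Rightarrow> nat) \<Rightarrow> (nat \<Rightarrow> nat \<Rightarrow> nat)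
      \<Rightarrow> ((nat \<Rightarrow> nat) \<Rightarrow> nat) \<Rightarrow> ((nat \<Rightarrow> nat) \<Rightarrow> nat) \<Rightarrow> bool" where
  "is_code q lam n R1 R2 \<epsilon> f1 f2 g1 g2 \<longleftrightarrow>
     (\<forall>i\<in>{1..n}. \<forall>m\<in>messages n R1. \<forall>s\<in>state_seqs n. f1 i m s < q) \<and>
     (\<forall>i\<in>{1..n}. \<forall>m\<in>messages n R2. f2 i m < q) \<and>
     g1 \<in> symbol_seqs q n \<rightarrow> messages n R1 \<and>
     g2 \<in> symbol_seqs q n \<rightarrow> messages n R2 \<and>
     measure_pmf.prob (source_pmf lam n R1 R2)
       {(m1, m2, s). g1 (received1 n f1 m1 s) \<noteq> m1} \<le> \<epsilon> \<and>
     measure_pmf.prob (source_pmf lam n R1 R2)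
       {(m1, m2, s). g2 (received2 q n f1 f2 m1 m2 s) \<noteq> m2} \<le> \<epsilon>"

definition achievable :: "nat \<Rightarrow> real \<Rightarrow> real \<times> real \<Rightarrow> bool" where
  "achievable q lam = (\<lambda>(R1, R2). 0 \<le> R1 \<and> 0 \<le> R2 \<and>
     (\<forall>\<epsilon>>0. \<exists>N. \<forall>n\<ge>N. \<exists>f1 f2 g1 g2. is_code q lam n R1 R2 \<epsilon> f1 f2 g1 g2))"

definition capacity_region :: "nat \<Rightarrow> real \<Rightarrow> (real \<times> real) set" where
  "capacity_region q lam = closure {R. achievable q lam R}"

text \<open>Probability vectors on the alphabet are functions of which only the values on \<open>{..<q}\<close>
  matter. The usual convention \<open>0 log 0 = 0\<close> holds automatically.\<close>

definition prob_simplex :: "nat \<Rightarrow> (nat \<Rightarrow> real) set" where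
  "prob_simplex q = {p. (\<forall>x<q. 0 \<le> p x) \<and> (\<Sum>x<q. p x) = 1}"

definition shannon_entropy :: "nat \<Rightarrow> (nat \<Rightarrow> real) \<Rightarrow> real" where
  "shannon_entropy q p = - (\<Sum>x<q. p x * log 2 (p x))"

definition delta0 :: "nat \<Rightarrow> real" where
  "delta0 x = (if x = 0 then 1 else 0)"

end

theory Submission
  imports Defs
begin

text \<open>Write \<open>V = S \<cdot> X\<^sub>1\<close> for the noise seen by receiver 2.

  Converse: \<open>n R\<^sub>1\<close> is at most about \<open>H(V\<^sup>n|S\<^sup>n) + n (1 - \<lambda>) log q\<close> and \<open>n R\<^sub>2\<close> at most about
  \<open>n log q - H(V\<^sup>n)\<close>. Independence of the \<open>S\<^sub>i\<close> gives \<open>I(S\<^sup>n;V\<^sup>n) \<ge> \<Sum>\<^sub>i I(S\<^sub>i;V\<^sub>i)\<close>, and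
  \<open>H(V\<^sup>n|S\<^sup>n) \<le> \<Sum>\<^sub>i H(V\<^sub>i|S\<^sub>i)\<close>; time sharing the laws of \<open>X\<^sub>1\<^sub>,\<^sub>i\<close> given \<open>S\<^sub>i = 1\<close> with \<open>\<delta>\<^sub>0\<close>
  single-letterizes the two bounds simultaneously. All these inequalities, Fano's included, are
  instances of Gibbs' inequality.

  Achievability: fix a set \<open>T\<close> of about \<open>2\<^bsup>H(V\<^sup>n)\<^esup>\<close> typical noise sequences. The inputs of encoder 1
  are coloured by messages, receiver 1 reads off the colour, and encoder 1 picks, in the colour
  class of its message, an input whose noise lies in \<open>T\<close>; a typical state leaves about
  \<open>2\<^bsup>H(X\<^sub>1\<^sup>n|S\<^sup>n)\<^esup>\<close> candidates. Receiver 2 decodes to the first codeword whose translate of \<open>T\<close> contains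
  its output. Points of the convex hull are reached by varying the letter law with time.\<close>

section \<open>Entropies and the channel\<close>

text \<open>The converse cannot treat the two rates separately. Subadditivity bounds
  \<open>H(V^n)\<close> from above, but the second rate contains it with a minus sign and needs a
  lower bound; only the difference \<open>H(V^n) - H(V^n|S^n)\<close> is bounded below by its
  letterwise sum. Hence the letter laws may overestimate both entropies, and
  \<open>hull_dominates\<close> scales them down together, which works because
  \<open>lam * H(p)\<close> never exceeds the entropy of \<open>state_mix lam p\<close>.

  In the achievability part the input is uniform where the state is 0: there it cannot disturb
  receiver 2, which accounts for the term \<open>(1 - lam) * log q\<close>.

  The strict inequalities in the claimed region are a separate obstacle: a law with one bound equal
  to 0 contributes no rate pair, although the pairs up to its bounds lie in the closure. Such points
  on the axes are approached by mixtures of the uniform law with \<open>delta0\<close>.\<close>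

lemma gibbs_inequality:
  fixes P Q :: "'a \<Rightarrow> real"
  assumes "finite A" and P: "\<And>x. x \<in> A \<Longrightarrow> 0 \<le> P x" and Q: "\<And>x. x \<in> A \<Longrightarrow> 0 \<le> Q x"
    and PQ: "\<And>x. x \<in> A \<Longrightarrow> P x > 0 \<Longrightarrow> Q x > 0" and le: "sum Q A \<le> sum P A"
  shows "(\<Sum>x\<in>A. P x * log 2 (Q x)) \<le> (\<Sum>x\<in>A. P x * log 2 (P x))"
proof -
  \<comment> \<open>Termwise form of \<open>ln t \<le> t - 1\<close> at
    \<open>t = Q x / P x\<close>. Only total masses are compared afterwards, so \<open>Q\<close> may
    have less mass than \<open>P\<close>.\<close>
  have *: "P x * log 2 (Q x) - P x * log 2 (P x) \<le> (Q x - P x) / ln 2" if x: "x \<in> A" for x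
  proof (cases "P x > 0")
    case True
    with PQ x have q: "Q x > 0" by auto
    have "P x * (ln (Q x) - ln (P x)) = P x * ln (Q x / P x)"
      using True q by (simp add: ln_div)
    also have "\<dots> \<le> P x * (Q x / P x - 1)"
      using True q by (intro mult_left_mono ln_le_minus_one) auto
    also have "\<dots> = Q x - P x" using True by (simp add: field_simps)
    finally have "P x * (ln (Q x) - ln (P x)) / ln 2 \<le> (Q x - P x) / ln 2"
      by (intro divide_right_mono) auto
    then show ?thesis by (simp add: log_def diff_divide_distrib right_diff_distrib)
  next
    case False
    with P[OF x] Q[OF x] show ?thesis by simp
  qed
  have "(\<Sum>x\<in>A. P x * log 2 (Q x)) - (\<Sum>x\<in>A. P x * log 2 (P x))
      \<le> (\<Sum>x\<in>A. (Q x - P x) / ln 2)"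
    unfolding sum_subtractf[symmetric] using * by (rule sum_mono)
  also have "\<dots> = (sum Q A - sum P A) / ln 2"
    by (simp add: sum_subtractf sum_divide_distrib[symmetric])
  also have "\<dots> \<le> 0" using le by (simp add: divide_nonpos_pos)
  finally show ?thesis by simp
qed

text \<open>The law of the noise letter \<open>S * X\<close> when \<open>X\<close> has law
  \<open>p\<close> given \<open>S = 1\<close>.\<close>

definition state_mix :: "real \<Rightarrow> (nat \<Rightarrow> real) \<Rightarrow> nat \<Rightarrow> real" where
  "state_mix lam p = (\<lambda>x. lam * p x + (1 - lam) * delta0 x)"

definition rate_bound1 :: "nat \<Rightarrow> real \<Rightarrow> (nat \<Rightarrow> real) \<Rightarrow> real" where
  "rate_bound1 q lam p = (1 - lam) * log 2 (real q) + lam * shannon_entropy q p"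

definition rate_bound2 :: "nat \<Rightarrow> real \<Rightarrow> (nat \<Rightarrow> real) \<Rightarrow> real" where
  "rate_bound2 q lam p = log 2 (real q) - shannon_entropy q (state_mix lam p)"

lemma sum_delta0: "0 < q \<Longrightarrow> (\<Sum>x<q. delta0 x * f x) = f 0"
  by (simp add: delta0_def if_distrib[of "\<lambda>t. t * _"] sum.delta cong: if_cong)

lemma sum_state_mix:
  assumes "0 < q"
  shows "(\<Sum>x<q. state_mix lam p x * f x) = lam * (\<Sum>x<q. p x * f x) + (1 - lam) * f 0"
proof -
  have "(\<Sum>x<q. state_mix lam p x * f x)
      = lam * (\<Sum>x<q. p x * f x) + (1 - lam) * (\<Sum>x<q. delta0 x * f x)"
    by (simp add: state_mix_def sum.distrib sum_distrib_left distrib_right mult.assoc)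
  then show ?thesis by (simp add: sum_delta0[OF assms])
qed

lemma delta0_simplex: "0 < q \<Longrightarrow> delta0 \<in> prob_simplex q"
  using sum_delta0[of q "\<lambda>_. 1"] by (auto simp: prob_simplex_def delta0_def)

lemma state_mix_simplex:
  assumes "p \<in> prob_simplex q" "0 \<le> lam" "lam \<le> 1" "0 < q"
  shows "state_mix lam p \<in> prob_simplex q"
proof -
  have "(\<Sum>x<q. state_mix lam p x) = 1"
    using assms sum_state_mix[of q lam p "\<lambda>_. 1"] by (simp add: prob_simplex_def)
  then show ?thesis
    using assms by (auto simp: prob_simplex_def state_mix_def delta0_def)
qed

lemma simplex_le_1: "p \<in> prob_simplex q \<Longrightarrow> x < q \<Longrightarrow> p x \<le> 1"
  using member_le_sum[of x "{..<q}" p] by (auto simp: prob_simplex_def)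

lemma log_prod:
  "finite I \<Longrightarrow> (\<And>i. i \<in> I \<Longrightarrow> 0 < f i) \<Longrightarrow> log 2 (\<Prod>i\<in>I. f i) = (\<Sum>i\<in>I. log 2 (f i :: real))"
  by (subst log_def, subst ln_prod) (force simp: log_def sum_divide_distrib)+

lemma log_le_0: "0 \<le> (t::real) \<Longrightarrow> t \<le> 1 \<Longrightarrow> log 2 t \<le> 0"
  \<comment> \<open>At 0 this rests on the convention \<open>log 2 0 = 0\<close>.\<close>
  by (cases "t = 0") (simp add: log_def, simp add: order_less_le)

lemma entropy_nonneg:
  assumes "p \<in> prob_simplex q" shows "0 \<le> shannon_entropy q p"
proof -
  have "p x * log 2 (p x) \<le> 0" if "x < q" for x
    using assms that simplex_le_1[OF assms that]
    by (cases "p x = 0")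
      (auto simp: prob_simplex_def intro!: mult_nonneg_nonpos simp: order_less_le)
  then show ?thesis unfolding shannon_entropy_def by (auto intro: sum_nonpos)
qed

lemma entropy_le_log:
  assumes "p \<in> prob_simplex q" "0 < q" shows "shannon_entropy q p \<le> log 2 (real q)"
proof -
  have "(\<Sum>x<q. p x * log 2 (1 / real q)) \<le> (\<Sum>x<q. p x * log 2 (p x))"
    using assms by (intro gibbs_inequality) (auto simp: prob_simplex_def)
  then show ?thesis using assms
    by (simp add: shannon_entropy_def sum_negf sum_distrib_right[symmetric] prob_simplex_def log_divide)
qed

text \<open>For one letter the left side is \<open>H(V|S)\<close> and the right side
  \<open>H(V)\<close>, since \<open>V\<close> is constant when \<open>S = 0\<close>. Gibbs'
  inequality handles the \<open>p\<close> part of the mixture; the \<open>delta0\<close> part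
  contributes \<open>- (1 - lam) * log 2 (state_mix lam p 0)\<close>, which is nonnegative.\<close>

lemma entropy_state_mix_ge:
  assumes p: "p \<in> prob_simplex q" and lam: "0 \<le> lam" "lam \<le> 1" and q: "0 < q"
  shows "lam * shannon_entropy q p \<le> shannon_entropy q (state_mix lam p)"
proof (cases "lam = 0")
  \<comment> \<open>For \<open>lam = 0\<close> the mixture can vanish where \<open>p\<close> does
    not, which rules out Gibbs' inequality for this pair.\<close>
  case True
  then show ?thesis using entropy_nonneg[OF state_mix_simplex[OF assms]] by simp
next
  case False
  with lam have l: "lam > 0" by simp
  let ?m = "state_mix lam p"
  note ms = state_mix_simplex[OF assms]
  have "(\<Sum>x<q. p x * log 2 (?m x)) \<le> (\<Sum>x<q. p x * log 2 (p x))"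
  proof (rule gibbs_inequality)
    show "?m x > 0" if "x \<in> {..<q}" "p x > 0" for x
      using that l lam by (simp add: state_mix_def delta0_def add_pos_nonneg)
  qed (use p ms in \<open>auto simp: prob_simplex_def\<close>)
  then have "lam * (\<Sum>x<q. p x * log 2 (?m x)) \<le> lam * (\<Sum>x<q. p x * log 2 (p x))"
    using l by simp
  moreover have "0 \<le> ?m 0" "?m 0 \<le> 1"
    using simplex_le_1[OF ms, of 0] ms q by (auto simp: prob_simplex_def)
  then have "log 2 (?m 0) \<le> 0" by (rule log_le_0)
  then have "(1 - lam) * log 2 (?m 0) \<le> 0" using lam by (simp add: mult_nonneg_nonpos)
  ultimately show ?thesis
    unfolding shannon_entropy_def by (simp add: sum_state_mix[OF q])
qed

lemma rate_bounds_nonneg: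
  assumes "p \<in> prob_simplex q" "0 \<le> lam" "lam \<le> 1" "0 < q"
  shows "0 \<le> rate_bound1 q lam p" "0 \<le> rate_bound2 q lam p"
  using assms entropy_nonneg[OF assms(1)] entropy_le_log[OF state_mix_simplex[OF assms]]
  by (auto simp: rate_bound1_def rate_bound2_def)

section \<open>Source and channel as finite weighted sums\<close>

definition state_weight :: "real \<Rightarrow> nat \<Rightarrow> (nat \<Rightarrow> bool) \<Rightarrow> real" where
  "state_weight lam n s = (\<Prod>i\<in>{1..n}. if s i then lam else 1 - lam)"

lemma state_weight_nonneg: "0 \<le> lam \<Longrightarrow> lam \<le> 1 \<Longrightarrow> 0 \<le> state_weight lam n s"
  unfolding state_weight_def by (intro prod_nonneg) auto

lemma finite_state_seqs: "finite (state_seqs n)"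
  by (simp add: state_seqs_def finite_PiE)

lemma finite_symbol_seqs: "finite (symbol_seqs q n)"
  by (simp add: symbol_seqs_def finite_PiE)

lemma sum_state_weight: "(\<Sum>s\<in>state_seqs n. state_weight lam n s) = 1"
proof -
  have "(\<Sum>s\<in>state_seqs n. state_weight lam n s)
      = (\<Prod>i\<in>{1..n}. \<Sum>b\<in>(UNIV::bool set). if b then lam else 1 - lam)"
    unfolding state_seqs_def state_weight_def by (subst prod_sum_PiE) auto
  also have "\<dots> = 1" by (simp add: UNIV_bool)
  finally show ?thesis .
qed

lemma messages_eq: "messages n R = {1..nat \<lfloor>2 powr (real n * R)\<rfloor>}"
  unfolding messages_def by (auto simp: le_nat_iff le_floor_iff)

lemma finite_messages: "finite (messages n R)" by (simp add: messages_eq)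

lemma one_in_messages: "0 \<le> R \<Longrightarrow> 1 \<in> messages n R"
  by (simp add: messages_def ge_one_powr_ge_zero)

lemma card_messages: "card (messages n R) = nat \<lfloor>2 powr (real n * R)\<rfloor>"
  by (simp add: messages_eq)

lemma card_messages_pos: "0 \<le> R \<Longrightarrow> 0 < card (messages n R)"
  using one_in_messages finite_messages card_gt_0_iff by blast

lemma card_messages_le: "real (card (messages n R)) \<le> 2 powr (real n * R)"
  by (simp add: card_messages)

text \<open>Rounding down costs at most one bit: an integer part \<open>L\<close> of at least 1
  satisfies \<open>2^(nR) < L + 1 \<le> 2 * L\<close>.\<close>

lemma log_card_messages_ge:
  assumes "0 \<le> R" shows "real n * R - 1 \<le> log 2 (card (messages n R))"
proof -
  let ?L = "real (card (messages n R))"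
  have L: "1 \<le> ?L" using card_messages_pos[OF assms, of n] by linarith
  have "2 powr (real n * R) < ?L + 1" unfolding card_messages by linarith
  with L have "2 powr (real n * R) \<le> 2 * ?L" by linarith
  then have "log 2 (2 powr (real n * R)) \<le> log 2 (2 * ?L)" using L by (subst log_le_cancel_iff) auto
  then show ?thesis using L by (simp add: log_mult)
qed

text \<open>The bridge from the \<open>pmf\<close> of the definition to finite sums. The default
  value \<open>undefined\<close> makes every sequence in the support extensional, hence an element
  of \<open>state_seqs n\<close>.\<close>

lemma source_prob_eq:
  assumes R: "0 \<le> R1" "0 \<le> R2" and lam: "0 \<le> lam" "lam \<le> 1"
  shows "measure_pmf.prob (source_pmf lam n R1 R2) {(m1, m2, s). \<Phi> m1 m2 s} =
    (\<Sum>m1\<in>messages n R1. \<Sum>m2\<in>messages n R2. \<Sum>s\<in>state_seqs n.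
      state_weight lam n s / (card (messages n R1) * card (messages n R2)) * of_bool (\<Phi> m1 m2 s))"
proof -
  let ?M1 = "messages n R1" and ?M2 = "messages n R2" and ?S = "state_seqs n"
  let ?p = "source_pmf lam n R1 R2" and ?E = "{(m1, m2, s). \<Phi> m1 m2 s}"
  have ne: "?M1 \<noteq> {}" "?M2 \<noteq> {}" using one_in_messages[OF R(1)] one_in_messages[OF R(2)] by auto
  have sub: "set_pmf ?p \<subseteq> ?M1 \<times> ?M2 \<times> ?S"
    using set_Pi_pmf_subset[of "{1..n}" undefined "\<lambda>_. bernoulli_pmf lam"]
    by (auto simp: source_pmf_def ne finite_messages state_seqs_def PiE_def extensional_def)
  have pmf: "pmf ?p (m1, m2, s) = state_weight lam n s / (card ?M1 * card ?M2)"
    if "m1 \<in> ?M1" "m2 \<in> ?M2" "s \<in> ?S" for m1 m2 s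
  proof -
    have "pmf (Pi_pmf {1..n} undefined (\<lambda>_. bernoulli_pmf lam)) s = state_weight lam n s"
      unfolding state_weight_def
      using that lam by (subst pmf_Pi') (auto simp: state_seqs_def PiE_def extensional_def
          intro!: prod.cong)
    then show ?thesis using that ne by (simp add: source_pmf_def pmf_pair finite_messages)
  qed
  have "measure_pmf.prob ?p ?E = measure_pmf.prob ?p (?E \<inter> (?M1 \<times> ?M2 \<times> ?S))"
    using sub by (intro measure_prob_cong_0) (auto simp: pmf_eq_0_set_pmf)
  also have "\<dots> = (\<Sum>z\<in>?E \<inter> (?M1 \<times> ?M2 \<times> ?S). pmf ?p z)"
    by (intro measure_measure_pmf_finite) (auto simp: finite_messages finite_state_seqs)
  also have "\<dots> = (\<Sum>z\<in>?M1 \<times> ?M2 \<times> ?S. pmf ?p z * of_bool (z \<in> ?E))"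
    by (intro sum.mono_neutral_cong_left) (auto simp: finite_messages finite_state_seqs)
  also have "\<dots> = (\<Sum>m1\<in>?M1. \<Sum>m2\<in>?M2. \<Sum>s\<in>?S. pmf ?p (m1, m2, s) * of_bool (\<Phi> m1 m2 s))"
    by (simp add: sum.cartesian_product case_prod_unfold)
  finally show ?thesis using pmf by (simp cong: sum.cong)
qed

definition noise :: "nat \<Rightarrow> (nat \<Rightarrow> bool) \<Rightarrow> (nat \<Rightarrow> nat) \<Rightarrow> nat \<Rightarrow> nat" where
  "noise n s x = (\<lambda>i\<in>{1..n}. if s i then x i else 0)"

definition seq_add :: "nat \<Rightarrow> nat \<Rightarrow> (nat \<Rightarrow> nat) \<Rightarrow> (nat \<Rightarrow> nat) \<Rightarrow> nat \<Rightarrow> nat" where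
  "seq_add q n x v = (\<lambda>i\<in>{1..n}. (x i + v i) mod q)"

lemma seq_add_in: "0 < q \<Longrightarrow> seq_add q n x v \<in> symbol_seqs q n"
  by (auto simp: seq_add_def symbol_seqs_def)

lemma noise_in: "0 < q \<Longrightarrow> x \<in> symbol_seqs q n \<Longrightarrow> noise n s x \<in> symbol_seqs q n"
  by (auto simp: noise_def symbol_seqs_def)

lemma add_mod_cancel:
  fixes x y v q :: nat
  assumes "(x + v) mod q = (y + v) mod q" "x < q" "y < q" shows "x = y"
proof -
  have "int (x + v) mod int q = int (y + v) mod int q"
    using assms(1) by (metis of_nat_mod)
  then have "int q dvd int (x + v) - int (y + v)" by (simp only: mod_eq_dvd_iff)
  then have "q dvd nat \<bar>int x - int y\<bar>" by simp
  then have "nat \<bar>int x - int y\<bar> = 0"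
    using assms(2,3) dvd_imp_le[of q "nat \<bar>int x - int y\<bar>"] by linarith
  then show ?thesis by simp
qed

lemma inj_seq_add_left: "inj_on (\<lambda>x. seq_add q n x v) (symbol_seqs q n)"
proof (rule inj_onI)
  fix x y assume x: "x \<in> symbol_seqs q n" and y: "y \<in> symbol_seqs q n"
    and eq: "seq_add q n x v = seq_add q n y v"
  have eqi: "x i = y i" if "i \<in> {1..n}" for i
  proof (rule add_mod_cancel[of "x i" "v i" q "y i"])
    show "(x i + v i) mod q = (y i + v i) mod q"
      using fun_cong[OF eq, of i] that by (simp add: seq_add_def)
    show "x i < q" "y i < q"
      using x y that unfolding symbol_seqs_def by (metis PiE_mem lessThan_iff)+
  qed
  show "x = y" by (rule PiE_ext[OF x[unfolded symbol_seqs_def] y[unfolded symbol_seqs_def] eqi])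
qed

lemma seq_add_commute: "seq_add q n x v = seq_add q n v x"
  by (simp add: seq_add_def add.commute)

lemma inj_seq_add_right: "inj_on (seq_add q n x) (symbol_seqs q n)"
  using inj_seq_add_left[of q n x] by (simp add: seq_add_commute[of q n _ x])

text \<open>Receiver 2 faces an additive noise channel whose noise is shaped by encoder 1. The
  unrestricted functions on the right are harmless, since \<open>noise\<close> and
  \<open>seq_add\<close> read only the positions \<open>1..n\<close>.\<close>

lemma received2_eq:
  "received2 q n f1 f2 m1 m2 s =
    seq_add q n (\<lambda>i. f2 i m2) (noise n s (\<lambda>i. f1 i m1 s))"
  by (auto simp: received2_def seq_add_def noise_def channel_out2_def)

section \<open>Converse\<close>

text \<open>Random variables are plain functions on a finite weighted space, and entropies are
  expected logarithms of \<open>marginal\<close>.\<close>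

locale finite_weights =
  fixes \<Omega> :: "'w set" and P :: "'w \<Rightarrow> real"
  assumes finite_space: "finite \<Omega>"
    and weight_nonneg: "\<And>w. w \<in> \<Omega> \<Longrightarrow> 0 \<le> P w"
    and sum_weight: "sum P \<Omega> = 1"
begin

definition marginal :: "('w \<Rightarrow> 'z) \<Rightarrow> 'z \<Rightarrow> real" where
  "marginal Z z = (\<Sum>w\<in>{w \<in> \<Omega>. Z w = z}. P w)"

lemma marginal_nonneg: "0 \<le> marginal Z z"
  unfolding marginal_def by (rule sum_nonneg) (use weight_nonneg in auto)

lemma weight_le_marginal: "w \<in> \<Omega> \<Longrightarrow> P w \<le> marginal Z (Z w)"
  unfolding marginal_def using finite_space weight_nonneg
  by (intro member_le_sum) auto

lemma sum_marginal:
  assumes "finite C" "Z ` \<Omega> \<subseteq> C"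
  shows "(\<Sum>z\<in>C. marginal Z z * F z) = (\<Sum>w\<in>\<Omega>. P w * F (Z w))"
proof -
  have "(\<Sum>w\<in>\<Omega>. P w * F (Z w)) = (\<Sum>z\<in>C. \<Sum>w\<in>{w \<in> \<Omega>. Z w = z}. P w * F (Z w))"
    using assms finite_space by (intro sum.group[symmetric]) auto
  also have "\<dots> = (\<Sum>z\<in>C. marginal Z z * F z)"
    by (auto simp: marginal_def sum_distrib_right intro!: sum.cong)
  finally show ?thesis by simp
qed

text \<open>Gibbs' inequality with \<open>Q\<close> as a guess at the law of \<open>Z\<close>;
  positivity is asked only at values taken with positive weight. The two noise entropy bounds below
  are choices of \<open>Z\<close> and \<open>Q\<close>.\<close>

lemma gibbs_marginal:
  assumes C: "finite C" "Z ` \<Omega> \<subseteq> C"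
    and Q: "\<And>z. z \<in> C \<Longrightarrow> 0 \<le> Q z" "sum Q C \<le> 1"
    and pos: "\<And>w. w \<in> \<Omega> \<Longrightarrow> 0 < P w \<Longrightarrow> 0 < Q (Z w)"
  shows "(\<Sum>w\<in>\<Omega>. P w * log 2 (Q (Z w))) \<le> (\<Sum>w\<in>\<Omega>. P w * log 2 (marginal Z (Z w)))"
proof -
  have "(\<Sum>z\<in>C. marginal Z z * log 2 (Q z)) \<le> (\<Sum>z\<in>C. marginal Z z * log 2 (marginal Z z))"
  proof (rule gibbs_inequality)
    fix z assume z: "z \<in> C" "0 < marginal Z z"
    then obtain w where "w \<in> \<Omega>" "Z w = z" "0 < P w"
      unfolding marginal_def using sum_nonpos[of "{w \<in> \<Omega>. Z w = z}" P] by force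
    then show "0 < Q z" using pos by blast
  next
    show "sum Q C \<le> sum (marginal Z) C"
      using sum_marginal[OF C, of "\<lambda>_. 1"] Q(2) by (simp add: sum_weight)
  qed (use C Q marginal_nonneg in auto)
  then show ?thesis by (simp add: sum_marginal[OF C])
qed

end

lemma state_weight_marginal:
  assumes "i \<in> {1..n}"
  shows "(\<Sum>s\<in>state_seqs n. state_weight lam n s * \<phi> (s i)) = lam * \<phi> True + (1 - lam) * \<phi> False"
proof -
  have "(\<Sum>s\<in>state_seqs n. state_weight lam n s * \<phi> (s i)) =
    (\<Sum>s\<in>{1..n} \<rightarrow>\<^sub>E UNIV. \<Prod>j\<in>{1..n}. (if s j then lam else 1 - lam) * (if j = i then \<phi> (s j) else 1))"
    unfolding state_seqs_def state_weight_def prod.distrib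
    using assms by (simp add: prod.delta)
  also have "\<dots> = (\<Prod>j\<in>{1..n}. \<Sum>b\<in>UNIV. (if b then lam else 1 - lam) * (if j = i then \<phi> b else 1))"
    by (subst prod_sum_PiE) auto
  also have "\<dots> = (\<Prod>j\<in>{1..n}. if j = i then lam * \<phi> True + (1 - lam) * \<phi> False else 1)"
    by (intro prod.cong) (auto simp: UNIV_bool)
  also have "\<dots> = lam * \<phi> True + (1 - lam) * \<phi> False"
    using assms by (simp add: prod.delta)
  finally show ?thesis .
qed

text \<open>A guess at the law of the message given the output: half the mass on the decoder's
  choice, half spread over \<open>L\<close> messages. Dropping the overlap keeps the total at most 1
  and makes the logarithm exactly -1, or -1 minus \<open>log L\<close> on errors; Fano's inequality
  then appears with the constant 1 in place of a binary entropy.\<close>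

definition fano_kernel :: "('y \<Rightarrow> 'm) \<Rightarrow> nat \<Rightarrow> 'm \<Rightarrow> 'y \<Rightarrow> real" where
  "fano_kernel g L m y = (if g y = m then 1 / 2 else 1 / (2 * real L))"

lemma fano_kernel_nonneg: "0 \<le> fano_kernel g L m y"
  by (simp add: fano_kernel_def)

lemma fano_kernel_pos: "0 < L \<Longrightarrow> 0 < fano_kernel g L m y"
  by (simp add: fano_kernel_def)

lemma sum_fano_kernel_le:
  assumes "finite M" "0 < card M"
  shows "(\<Sum>m\<in>M. fano_kernel g (card M) m y) \<le> 1"
proof -
  have "(\<Sum>m\<in>M. fano_kernel g (card M) m y)
      \<le> (\<Sum>m\<in>M. (if m = g y then 1 / 2 else 0) + 1 / (2 * real (card M)))"
    by (intro sum_mono) (auto simp: fano_kernel_def)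
  also have "\<dots> = (\<Sum>m\<in>M. if m = g y then 1 / 2 else 0) + 1 / 2"
    using assms by (auto simp: sum.distrib)
  also have "\<dots> \<le> 1" using assms by (simp add: sum.delta)
  finally show ?thesis .
qed

lemma log_fano_kernel:
  "0 < L \<Longrightarrow> log 2 (fano_kernel g L m y) = - 1 - of_bool (g y \<noteq> m) * log 2 (real L)"
  by (simp add: fano_kernel_def log_divide log_mult)

section \<open>The noise produced by a fixed encoder 1\<close>

locale z_encoder =
  fixes q n :: nat and lam :: real and M :: "nat set" and x :: "nat \<Rightarrow> (nat \<Rightarrow> bool) \<Rightarrow> nat \<Rightarrow> nat"
  assumes q: "0 < q" and lam: "0 \<le> lam" "lam \<le> 1"
    and M: "finite M" "M \<noteq> {}"
    and x_in: "\<And>m s. m \<in> M \<Longrightarrow> s \<in> state_seqs n \<Longrightarrow> x m s \<in> symbol_seqs q n"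
begin

definition P :: "nat \<times> (nat \<Rightarrow> bool) \<Rightarrow> real" where
  "P w = state_weight lam n (snd w) / card M"

definition V :: "nat \<times> (nat \<Rightarrow> bool) \<Rightarrow> nat \<Rightarrow> nat" where
  "V w = noise n (snd w) (x (fst w) (snd w))"

lemma card_M: "0 < card M" using M by (simp add: card_gt_0_iff)

lemma sum_P: "(\<Sum>w\<in>M \<times> state_seqs n. P w * F w)
   = (\<Sum>m\<in>M. \<Sum>s\<in>state_seqs n. state_weight lam n s / card M * F (m, s))"
  by (simp add: P_def sum.cartesian_product case_prod_unfold)

lemma sum_P_state: "(\<Sum>w\<in>M \<times> state_seqs n. P w * F (snd w))
   = (\<Sum>s\<in>state_seqs n. state_weight lam n s * F s)"
  using card_M by (simp add: sum_P sum_divide_distrib[symmetric])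

sublocale finite_weights "M \<times> state_seqs n" P
proof
  show "sum P (M \<times> state_seqs n) = 1"
    using sum_P_state[of "\<lambda>_. 1"] by (simp add: sum_state_weight)
qed (use M lam in \<open>auto simp: finite_state_seqs P_def state_weight_nonneg\<close>)

lemma V_in: "w \<in> M \<times> state_seqs n \<Longrightarrow> V w \<in> symbol_seqs q n"
  using q x_in by (auto simp: V_def intro!: noise_in)

lemma V_less: "w \<in> M \<times> state_seqs n \<Longrightarrow> i \<in> {1..n} \<Longrightarrow> V w i < q"
  using V_in[of w] by (auto simp: symbol_seqs_def)

lemma V_off: "i \<in> {1..n} \<Longrightarrow> \<not> snd w i \<Longrightarrow> V w i = 0"
  by (simp add: V_def noise_def)

text \<open>The law of the \<open>i\<close>-th input of encoder 1 given \<open>S_i = 1\<close>. For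
  \<open>lam = 0\<close> there is nothing to condition on, and \<open>delta0\<close> keeps it a
  probability law.\<close>

definition input_law :: "nat \<Rightarrow> nat \<Rightarrow> real" where
  "input_law i v = (if lam = 0 then delta0 v
     else (\<Sum>w\<in>M \<times> state_seqs n. P w * of_bool (snd w i \<and> V w i = v)) / lam)"

lemma sum_on:
  assumes i: "i \<in> {1..n}"
  shows "(\<Sum>w\<in>M \<times> state_seqs n. P w * of_bool (snd w i)) = lam"
  using sum_P_state[of "\<lambda>s. of_bool (s i)"] state_weight_marginal[OF i, of lam of_bool] by simp

lemma lam_input_law:
  assumes i: "i \<in> {1..n}"
  shows "lam * input_law i v = (\<Sum>w\<in>M \<times> state_seqs n. P w * of_bool (snd w i \<and> V w i = v))"
proof (cases "lam = 0")
  case True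
  have "(\<Sum>w\<in>M \<times> state_seqs n. P w * of_bool (snd w i \<and> V w i = v))
      \<le> (\<Sum>w\<in>M \<times> state_seqs n. P w * of_bool (snd w i))"
    using weight_nonneg by (intro sum_mono) auto
  moreover have "0 \<le> (\<Sum>w\<in>M \<times> state_seqs n. P w * of_bool (snd w i \<and> V w i = v))"
    using weight_nonneg by (intro sum_nonneg) auto
  ultimately show ?thesis using True sum_on[OF i] by simp
qed (simp add: input_law_def)

text \<open>The pair \<open>(S_i, V_i)\<close> is concentrated on the values
  \<open>(True, v)\<close>, of weight \<open>lam * input_law i v\<close>, and
  \<open>(False, 0)\<close>. All single-letter expectations are read off from this.\<close>

lemma sum_letter:
  assumes i: "i \<in> {1..n}"
  shows "(\<Sum>w\<in>M \<times> state_seqs n. P w * F (snd w i) (V w i))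
    = lam * (\<Sum>v<q. input_law i v * F True v) + (1 - lam) * F False 0"
proof -
  let ?\<Omega> = "M \<times> state_seqs n"
  have "(\<Sum>w\<in>?\<Omega>. P w * F (snd w i) (V w i))
     = (\<Sum>w\<in>?\<Omega>. (\<Sum>v<q. P w * of_bool (snd w i \<and> V w i = v) * F True v)
         + (P w - P w * of_bool (snd w i)) * F False 0)"
  proof (rule sum.cong[OF refl])
    fix w assume w: "w \<in> ?\<Omega>"
    have "(\<Sum>v<q. P w * of_bool (snd w i \<and> V w i = v) * F True v)
        = (\<Sum>v<q. if v = V w i then P w * of_bool (snd w i) * F True v else 0)"
      by (intro sum.cong) auto
    then show "P w * F (snd w i) (V w i) =
        (\<Sum>v<q. P w * of_bool (snd w i \<and> V w i = v) * F True v)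
         + (P w - P w * of_bool (snd w i)) * F False 0"
      using V_less[OF w i] V_off[OF i, of w] by (cases "snd w i") (auto simp: sum.delta)
  qed
  also have "\<dots> = (\<Sum>v<q. (\<Sum>w\<in>?\<Omega>. P w * of_bool (snd w i \<and> V w i = v)) * F True v)
      + ((\<Sum>w\<in>?\<Omega>. P w) - (\<Sum>w\<in>?\<Omega>. P w * of_bool (snd w i))) * F False 0"
    unfolding sum.distrib
    by (subst sum.swap) (simp add: sum_distrib_right sum_subtractf[symmetric] left_diff_distrib)
  also have "\<dots> = lam * (\<Sum>v<q. input_law i v * F True v) + (1 - lam) * F False 0"
    by (simp only: lam_input_law[OF i, symmetric] sum_on[OF i] sum_weight sum_distrib_left mult.assoc)
  finally show ?thesis .
qed

lemma input_law_nonneg: "0 \<le> input_law i v"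
  unfolding input_law_def delta0_def using lam weight_nonneg
  by (auto intro!: divide_nonneg_nonneg sum_nonneg)

lemma input_law_simplex:
  assumes i: "i \<in> {1..n}"
  shows "input_law i \<in> prob_simplex q"
proof (cases "lam = 0")
  case True
  have "input_law i = delta0"
    unfolding fun_eq_iff input_law_def using True by simp
  then show ?thesis using delta0_simplex[OF q] by simp
next
  case False
  have "lam = lam * (\<Sum>v<q. input_law i v)"
    using sum_letter[OF i, of "\<lambda>b _. of_bool b"] sum_on[OF i] by simp
  with False show ?thesis by (simp add: prob_simplex_def input_law_nonneg)
qed

text \<open>The law of \<open>V_i\<close> given \<open>S_i = b\<close>.\<close>

definition letter_kernel :: "nat \<Rightarrow> bool \<Rightarrow> nat \<Rightarrow> real" where
  "letter_kernel i b v = (if b then input_law i v else delta0 v)"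

definition letter_weight :: "bool \<Rightarrow> real" where
  "letter_weight b = (if b then lam else 1 - lam)"

lemma state_weight_letters: "state_weight lam n s = (\<Prod>i\<in>{1..n}. letter_weight (s i))"
  by (simp add: state_weight_def letter_weight_def)

lemma letter_kernel_nonneg: "0 \<le> letter_kernel i b v"
  by (simp add: letter_kernel_def input_law_nonneg delta0_def)

lemma letter_weight_nonneg: "0 \<le> letter_weight b"
  using lam by (simp add: letter_weight_def)

lemma state_mix_letters:
  "state_mix lam (input_law i) v = (\<Sum>b\<in>UNIV. letter_weight b * letter_kernel i b v)"
  by (simp add: UNIV_bool state_mix_def letter_weight_def letter_kernel_def)

lemma sum_letter_kernel: "i \<in> {1..n} \<Longrightarrow> (\<Sum>v<q. letter_kernel i b v) = 1"
  using input_law_simplex[of i] delta0_simplex[OF q]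
  by (cases b) (simp_all add: letter_kernel_def prob_simplex_def)

text \<open>Supplies the positivity required by Gibbs' inequality and by splitting logarithms of
  products into sums.\<close>

lemma positive_letters:
  assumes w: "w \<in> M \<times> state_seqs n" "0 < P w" and i: "i \<in> {1..n}"
  shows "0 < letter_weight (snd w i)" "0 < letter_kernel i (snd w i) (V w i)"
    "0 < state_mix lam (input_law i) (V w i)"
proof -
  have "state_weight lam n (snd w) \<noteq> 0" using w(2) by (auto simp: P_def)
  then have "letter_weight (snd w i) \<noteq> 0"
    using i unfolding state_weight_letters by (metis finite_atLeastAtMost prod_zero)
  then show lw: "0 < letter_weight (snd w i)" using letter_weight_nonneg[of "snd w i"] by simp
  show lk: "0 < letter_kernel i (snd w i) (V w i)"
  proof (cases "snd w i")
    case True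
    have "P w * of_bool (snd w i \<and> V w i = V w i)
        \<le> (\<Sum>u\<in>M \<times> state_seqs n. P u * of_bool (snd u i \<and> V u i = V w i))"
      by (rule member_le_sum) (use w weight_nonneg finite_space in auto)
    with True w(2) have "0 < lam * input_law i (V w i)" by (simp add: lam_input_law[OF i])
    then show ?thesis using True lam input_law_nonneg[of i "V w i"]
      by (simp add: letter_kernel_def zero_less_mult_iff)
  next
    case False
    then show ?thesis using V_off[OF i] by (simp add: letter_kernel_def delta0_def)
  qed
  have "0 < letter_weight (snd w i) * letter_kernel i (snd w i) (V w i)" using lw lk by simp
  also have "\<dots> \<le> state_mix lam (input_law i) (V w i)"
    unfolding state_mix_letters
    by (rule member_le_sum) (auto simp: letter_weight_nonneg letter_kernel_nonneg)
  finally show "0 < state_mix lam (input_law i) (V w i)" .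
qed

text \<open>\<open>log_S\<close>, \<open>log_V\<close> and \<open>log_SV\<close> are \<open>- H(S\<^sup>n)\<close>, \<open>- H(V\<^sup>n)\<close> and \<open>- H(S\<^sup>n, V\<^sup>n)\<close>.\<close>

definition log_S :: real where
  "log_S = (\<Sum>w\<in>M \<times> state_seqs n. P w * log 2 (state_weight lam n (snd w)))"

definition log_V :: real where
  "log_V = (\<Sum>w\<in>M \<times> state_seqs n. P w * log 2 (marginal V (V w)))"

definition SV :: "nat \<times> (nat \<Rightarrow> bool) \<Rightarrow> (nat \<Rightarrow> bool) \<times> (nat \<Rightarrow> nat)" where
  "SV w = (snd w, V w)"

definition log_SV :: real where
  "log_SV = (\<Sum>w\<in>M \<times> state_seqs n. P w * log 2 (marginal SV (SV w)))"

text \<open>Logarithm laws need positive arguments, so sums are rewritten only at points of positive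
  weight.\<close>

lemma sum_cong_pos:
  assumes "\<And>w. w \<in> M \<times> state_seqs n \<Longrightarrow> 0 < P w \<Longrightarrow> F w = G w"
  shows "(\<Sum>w\<in>M \<times> state_seqs n. P w * F w) = (\<Sum>w\<in>M \<times> state_seqs n. P w * G w)"
  using assms weight_nonneg by (intro sum.cong refl) (metis mult_eq_0_iff order_le_less)

lemma sum_log_kernel:
  "i \<in> {1..n} \<Longrightarrow> (\<Sum>w\<in>M \<times> state_seqs n. P w * log 2 (letter_kernel i (snd w i) (V w i)))
    = - (lam * shannon_entropy q (input_law i))"
  by (subst sum_letter[of i "\<lambda>b v. log 2 (letter_kernel i b v)"])
    (simp_all add: letter_kernel_def shannon_entropy_def delta0_def)

lemma sum_log_mix:
  assumes i: "i \<in> {1..n}"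
  shows "(\<Sum>w\<in>M \<times> state_seqs n. P w * log 2 (state_mix lam (input_law i) (V w i)))
    = - shannon_entropy q (state_mix lam (input_law i))"
proof -
  show ?thesis
    by (subst sum_letter[OF i, of "\<lambda>b v. log 2 (state_mix lam (input_law i) v)"])
      (simp add: shannon_entropy_def sum_state_mix[OF q])
qed

lemma SV_in: "SV ` (M \<times> state_seqs n) \<subseteq> state_seqs n \<times> symbol_seqs q n"
  using V_in by (auto simp: SV_def)

lemma finite_SV: "finite (state_seqs n \<times> symbol_seqs q n)"
  by (simp add: finite_state_seqs finite_symbol_seqs)

lemma state_weight_pos: "w \<in> M \<times> state_seqs n \<Longrightarrow> 0 < P w \<Longrightarrow> 0 < state_weight lam n (snd w)"
  using state_weight_nonneg[OF lam, of n "snd w"] by (auto simp: P_def zero_less_divide_iff)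

text \<open>The left side is \<open>H(V^n|S^n)\<close>. The comparison law \<open>?Q\<close> gives
  the states their true law and makes the noise letters conditionally independent given
  them.\<close>

lemma conditional_noise_entropy_le:
  "log_S - log_SV \<le> (\<Sum>i\<in>{1..n}. lam * shannon_entropy q (input_law i))"
proof -
  let ?\<Omega> = "M \<times> state_seqs n"
  let ?Q = "\<lambda>(s, v). state_weight lam n s * (\<Prod>i\<in>{1..n}. letter_kernel i (s i) (v i))"
  have "(\<Sum>w\<in>?\<Omega>. P w * log 2 (?Q (SV w))) \<le> log_SV"
    unfolding log_SV_def
  proof (rule gibbs_marginal[OF finite_SV SV_in])
    have "sum ?Q (state_seqs n \<times> symbol_seqs q n)
       = (\<Sum>s\<in>state_seqs n. state_weight lam n s *
           (\<Sum>v\<in>symbol_seqs q n. \<Prod>i\<in>{1..n}. letter_kernel i (s i) (v i)))"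
      by (simp add: sum.cartesian_product[symmetric] sum_distrib_left)
    also have "\<dots> = (\<Sum>s\<in>state_seqs n. state_weight lam n s *
           (\<Prod>i\<in>{1..n}. \<Sum>v<q. letter_kernel i (s i) v))"
      unfolding symbol_seqs_def by (subst prod_sum_PiE) auto
    finally show "sum ?Q (state_seqs n \<times> symbol_seqs q n) \<le> 1"
      by (simp add: sum_letter_kernel sum_state_weight)
  next
    fix w assume w: "w \<in> ?\<Omega>" "0 < P w"
    then show "0 < ?Q (SV w)"
      using state_weight_pos[OF w] positive_letters(2)[OF w]
      by (auto simp: SV_def intro!: mult_pos_pos prod_pos)
  qed (auto intro!: mult_nonneg_nonneg prod_nonneg letter_kernel_nonneg state_weight_nonneg lam)
  also have "(\<Sum>w\<in>?\<Omega>. P w * log 2 (?Q (SV w)))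
    = (\<Sum>w\<in>?\<Omega>. P w * (log 2 (state_weight lam n (snd w))
        + (\<Sum>i\<in>{1..n}. log 2 (letter_kernel i (snd w i) (V w i)))))"
  proof (rule sum_cong_pos)
    fix w assume w: "w \<in> ?\<Omega>" "0 < P w"
    show "log 2 (?Q (SV w)) = log 2 (state_weight lam n (snd w))
        + (\<Sum>i\<in>{1..n}. log 2 (letter_kernel i (snd w i) (V w i)))"
      using log_mult_pos[OF state_weight_pos[OF w]
          prod_pos[of "{1..n}" "\<lambda>i. letter_kernel i (snd w i) (V w i)", OF positive_letters(2)[OF w]]]
        log_prod[of "{1..n}" "\<lambda>i. letter_kernel i (snd w i) (V w i)", OF _ positive_letters(2)[OF w]]
      by (simp add: SV_def)
  qed
  also have "\<dots> = log_S
      + (\<Sum>i\<in>{1..n}. \<Sum>w\<in>?\<Omega>. P w * log 2 (letter_kernel i (snd w i) (V w i)))"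
    unfolding distrib_left sum.distrib log_S_def sum_distrib_left by (subst sum.swap) simp
  finally show ?thesis by (simp add: sum_log_kernel sum_negf)
qed

text \<open>The right side is \<open>I(S^n;V^n)\<close>. The comparison law keeps the true law of
  \<open>V^n\<close> and draws each \<open>S_i\<close> from its conditional law given
  \<open>V_i\<close> alone. Independence of the states enters because the factors
  \<open>letter_weight\<close> multiply to \<open>state_weight\<close>, so that \<open>log_S\<close>
  reappears.\<close>

lemma noise_information_ge:
  "(\<Sum>i\<in>{1..n}. shannon_entropy q (state_mix lam (input_law i)) - lam * shannon_entropy q (input_law i))
    \<le> log_SV - log_S - log_V"
proof -
  let ?\<Omega> = "M \<times> state_seqs n"
  let ?m = "\<lambda>i. state_mix lam (input_law i)"
  let ?r = "\<lambda>i b v. letter_weight b * letter_kernel i b v / ?m i v"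
  let ?Q = "\<lambda>(s, v). marginal V v * (\<Prod>i\<in>{1..n}. ?r i (s i) (v i))"
  have V_sub: "V ` ?\<Omega> \<subseteq> symbol_seqs q n" using V_in by auto
  have r_nonneg: "0 \<le> ?r i b v" for i b v
    unfolding state_mix_letters
    by (intro divide_nonneg_nonneg mult_nonneg_nonneg sum_nonneg letter_weight_nonneg letter_kernel_nonneg)
  \<comment> \<open>Equality fails where the mixture vanishes: division by zero makes the sum 0
    there.\<close>
  have sum_r: "(\<Sum>b\<in>UNIV. ?r i b v) \<le> 1" for i v
    unfolding sum_divide_distrib[symmetric] state_mix_letters[symmetric] by simp
  have "(\<Sum>w\<in>?\<Omega>. P w * log 2 (?Q (SV w))) \<le> log_SV"
    unfolding log_SV_def
  proof (rule gibbs_marginal[OF finite_SV SV_in])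
    have "sum ?Q (state_seqs n \<times> symbol_seqs q n)
       = (\<Sum>v\<in>symbol_seqs q n. marginal V v *
           (\<Sum>s\<in>state_seqs n. \<Prod>i\<in>{1..n}. ?r i (s i) (v i)))"
      by (simp add: sum.cartesian_product[symmetric] sum_distrib_left) (rule sum.swap)
    also have "\<dots> = (\<Sum>v\<in>symbol_seqs q n. marginal V v *
           (\<Prod>i\<in>{1..n}. \<Sum>b\<in>UNIV. ?r i b (v i)))"
      unfolding state_seqs_def by (subst prod_sum_PiE) auto
    also have "\<dots> \<le> (\<Sum>v\<in>symbol_seqs q n. marginal V v * 1)"
      using sum_r r_nonneg
      by (intro sum_mono mult_left_mono prod_le_1 marginal_nonneg conjI sum_nonneg) auto
    also have "\<dots> = 1"
      using sum_marginal[OF finite_symbol_seqs V_sub, of "\<lambda>_. 1"] by (simp add: sum_weight)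
    finally show "sum ?Q (state_seqs n \<times> symbol_seqs q n) \<le> 1" .
  next
    fix w assume w: "w \<in> ?\<Omega>" "0 < P w"
    have "0 < marginal V (V w)" using weight_le_marginal[OF w(1), of V] w(2) by simp
    then show "0 < ?Q (SV w)"
      using positive_letters[OF w]
      by (auto simp: SV_def intro!: mult_pos_pos prod_pos divide_pos_pos)
  next
    fix z assume "z \<in> state_seqs n \<times> symbol_seqs q n"
    show "0 \<le> ?Q z"
      using r_nonneg by (auto simp: case_prod_unfold intro!: mult_nonneg_nonneg prod_nonneg marginal_nonneg)
  qed
  also have "(\<Sum>w\<in>?\<Omega>. P w * log 2 (?Q (SV w)))
    = (\<Sum>w\<in>?\<Omega>. P w * (log 2 (marginal V (V w)) + log 2 (state_weight lam n (snd w))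
        + (\<Sum>i\<in>{1..n}. log 2 (letter_kernel i (snd w i) (V w i)) - log 2 (?m i (V w i)))))"
  proof (rule sum_cong_pos)
    fix w assume w: "w \<in> ?\<Omega>" "0 < P w"
    have mp: "0 < marginal V (V w)" using weight_le_marginal[OF w(1), of V] w(2) by simp
    have r: "0 < ?r i (snd w i) (V w i)" if "i \<in> {1..n}" for i
      using positive_letters[OF w that] by simp
    have "log 2 (?Q (SV w)) = log 2 (marginal V (V w)) +
        log 2 (\<Prod>i\<in>{1..n}. ?r i (snd w i) (V w i))"
      using log_mult_pos[OF mp prod_pos[of "{1..n}" "\<lambda>i. ?r i (snd w i) (V w i)", OF r]] by (simp add: SV_def)
    also have "log 2 (\<Prod>i\<in>{1..n}. ?r i (snd w i) (V w i))
        = (\<Sum>i\<in>{1..n}. log 2 (?r i (snd w i) (V w i)))"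
      by (rule log_prod) (use r in auto)
    also have "(\<Sum>i\<in>{1..n}. log 2 (?r i (snd w i) (V w i)))
      = (\<Sum>i\<in>{1..n}. log 2 (letter_weight (snd w i))
         + (log 2 (letter_kernel i (snd w i) (V w i)) - log 2 (?m i (V w i))))"
      using positive_letters[OF w] by (intro sum.cong) (auto simp: log_mult_pos log_divide_pos)
    also have "\<dots> = log 2 (state_weight lam n (snd w))
         + (\<Sum>i\<in>{1..n}. log 2 (letter_kernel i (snd w i) (V w i)) - log 2 (?m i (V w i)))"
      unfolding state_weight_letters sum.distrib
      using log_prod[of "{1..n}" "\<lambda>i. letter_weight (snd w i)", OF _ positive_letters(1)[OF w]]
      by simp
    finally show "log 2 (?Q (SV w)) = log 2 (marginal V (V w)) + log 2 (state_weight lam n (snd w))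
        + (\<Sum>i\<in>{1..n}. log 2 (letter_kernel i (snd w i) (V w i)) - log 2 (?m i (V w i)))"
      by simp
  qed
  also have "\<dots> = log_V + log_S
      + (\<Sum>i\<in>{1..n}. \<Sum>w\<in>?\<Omega>. P w * (log 2 (letter_kernel i (snd w i) (V w i)) - log 2 (?m i (V w i))))"
    unfolding distrib_left sum.distrib log_S_def log_V_def sum_distrib_left by (subst sum.swap) simp
  finally show ?thesis
    by (simp add: right_diff_distrib sum_subtractf sum_log_kernel sum_log_mix)
qed

lemma log_V_nonpos: "log_V \<le> 0"
proof -
  have "marginal V v \<le> 1" for v
    unfolding marginal_def sum_weight[symmetric]
    using finite_space weight_nonneg by (intro sum_mono2) auto
  then have "log 2 (marginal V v) \<le> 0" for v
    by (intro log_le_0 marginal_nonneg)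
  then show ?thesis unfolding log_V_def
    using weight_nonneg by (auto intro!: sum_nonpos mult_nonneg_nonpos)
qed

text \<open>The noise reveals the input wherever the state is 1; only the other positions are
  free.\<close>

lemma card_noise_fibre_le:
  assumes s: "s \<in> state_seqs n"
  shows "card {y \<in> symbol_seqs q n. noise n s y = v} \<le> q ^ card {i \<in> {1..n}. \<not> s i}"
proof -
  have "{y \<in> symbol_seqs q n. noise n s y = v}
      \<subseteq> PiE {1..n} (\<lambda>i. if s i then {v i} else {..<q})"
    by (auto simp: symbol_seqs_def noise_def PiE_def Pi_def)
  then have "card {y \<in> symbol_seqs q n. noise n s y = v}
      \<le> card (PiE {1..n} (\<lambda>i. if s i then {v i} else {..<q}))"
    by (intro card_mono finite_PiE) auto
  also have "\<dots> = (\<Prod>i\<in>{1..n}. if s i then 1 else q)"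
    by (auto simp: card_PiE intro!: prod.cong)
  also have "\<dots> = q ^ card {i \<in> {1..n}. \<not> s i}"
    by (simp add: prod.If_cases Int_def)
  finally show ?thesis .
qed

lemma sum_card_off: "(\<Sum>w\<in>M \<times> state_seqs n. P w * real (card {i \<in> {1..n}. \<not> snd w i})) = n * (1 - lam)"
proof -
  have "real (card {i \<in> {1..n}. \<not> s i}) = (\<Sum>i\<in>{1..n}. of_bool (\<not> s i))" for s :: "nat \<Rightarrow> bool"
    by (simp add: of_bool_def sum.If_cases Int_def)
  then have "(\<Sum>w\<in>M \<times> state_seqs n. P w * real (card {i \<in> {1..n}. \<not> snd w i}))
     = (\<Sum>i\<in>{1..n}. \<Sum>w\<in>M \<times> state_seqs n. P w * of_bool (\<not> snd w i))"
    by (simp only: sum_distrib_left) (rule sum.swap)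
  also have "\<dots> = (\<Sum>i\<in>{1..n}. 1 - lam)"
    by (intro sum.cong refl) (subst sum_letter[of _ "\<lambda>b _. of_bool (\<not> b)"], auto)
  finally show ?thesis by simp
qed

text \<open>Receiver 1 sees the input itself, which carries at most the noise and
  \<open>log q\<close> bits for each position in state 0. Accordingly \<open>?Q\<close> takes the
  true law of state and noise, divides it by a bound on the number of inputs with that noise, and
  multiplies by the Fano kernel for the message.\<close>

lemma message1_bound:
  fixes g :: "(nat \<Rightarrow> nat) \<Rightarrow> nat"
  assumes err: "(\<Sum>w\<in>M \<times> state_seqs n. P w * of_bool (g (x (fst w) (snd w)) \<noteq> fst w)) \<le> e"
  shows "(1 - e) * log 2 (card M) \<le> log_S - log_SV + n * (1 - lam) * log 2 q + 1"
proof -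
  let ?\<Omega> = "M \<times> state_seqs n" and ?L = "card M"
  let ?off = "\<lambda>s::nat \<Rightarrow> bool. card {i \<in> {1..n}. \<not> s i}"
  let ?x = "\<lambda>w. x (fst w) (snd w)"
  let ?k = "fano_kernel g ?L"
  let ?h = "\<lambda>s y. marginal SV (s, noise n s y) / real q ^ ?off s"
  let ?Q = "\<lambda>w. ?h (snd w) (?x w) * ?k (fst w) (?x w)"
  note L = card_M
  have h_nonneg: "0 \<le> ?h s y" for s y
    by (intro divide_nonneg_nonneg marginal_nonneg) simp
  have hsum: "(\<Sum>y\<in>symbol_seqs q n. ?h s y) \<le> (\<Sum>v\<in>symbol_seqs q n. marginal SV (s, v))"
    if s: "s \<in> state_seqs n" for s
  proof -
    have "(\<Sum>y\<in>symbol_seqs q n. ?h s y)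
        = (\<Sum>v\<in>symbol_seqs q n. \<Sum>y\<in>{y \<in> symbol_seqs q n. noise n s y = v}. ?h s y)"
      using noise_in[OF q] finite_symbol_seqs by (intro sum.group[symmetric]) auto
    also have "\<dots> = (\<Sum>v\<in>symbol_seqs q n. marginal SV (s, v) *
        (card {y \<in> symbol_seqs q n. noise n s y = v} / real q ^ ?off s))"
      by (intro sum.cong) auto
    also have "\<dots> \<le> (\<Sum>v\<in>symbol_seqs q n. marginal SV (s, v) * 1)"
    proof (intro sum_mono mult_left_mono marginal_nonneg)
      fix v
      have "real (card {y \<in> symbol_seqs q n. noise n s y = v}) \<le> real (q ^ ?off s)"
        using card_noise_fibre_le[OF s, of v] by (simp only: of_nat_le_iff)
      then show "real (card {y \<in> symbol_seqs q n. noise n s y = v}) / real q ^ ?off s \<le> 1"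
        using q by (simp add: divide_le_eq)
    qed
    finally show ?thesis by simp
  qed
  have "(\<Sum>w\<in>?\<Omega>. P w * log 2 (?Q w)) \<le> (\<Sum>w\<in>?\<Omega>. P w * log 2 (P w))"
  proof (rule gibbs_inequality[OF finite_space])
    have "sum ?Q ?\<Omega> = (\<Sum>s\<in>state_seqs n. \<Sum>m\<in>M. ?h s (x m s) * ?k m (x m s))"
      by (subst sum.swap) (simp add: sum.cartesian_product case_prod_unfold)
    \<comment> \<open>Enlarging the actual input to all inputs \<open>y\<close> removes the encoder,
      so that the Fano kernel can be summed over messages for fixed \<open>y\<close>.\<close>
    also have "\<dots> \<le> (\<Sum>s\<in>state_seqs n. \<Sum>m\<in>M. \<Sum>y\<in>symbol_seqs q n. ?h s y * ?k m y)"
    proof (intro sum_mono)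
      fix s m assume "s \<in> state_seqs n" "m \<in> M"
      then have "x m s \<in> symbol_seqs q n" by (rule x_in[rotated])
      then show "?h s (x m s) * ?k m (x m s) \<le> (\<Sum>y\<in>symbol_seqs q n. ?h s y * ?k m y)"
        using h_nonneg fano_kernel_nonneg finite_symbol_seqs
        by (intro member_le_sum[of "x m s" _ "\<lambda>y. ?h s y * ?k m y"] mult_nonneg_nonneg) auto
    qed
    also have "\<dots> = (\<Sum>s\<in>state_seqs n. \<Sum>y\<in>symbol_seqs q n. ?h s y * (\<Sum>m\<in>M. ?k m y))"
      by (rule sum.cong[OF refl], subst sum.swap) (simp only: sum_distrib_left)
    also have "\<dots> \<le> (\<Sum>s\<in>state_seqs n. \<Sum>y\<in>symbol_seqs q n. ?h s y * 1)"
      by (intro sum_mono mult_left_mono sum_fano_kernel_le M L h_nonneg)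
    also have "\<dots> \<le> (\<Sum>s\<in>state_seqs n. \<Sum>v\<in>symbol_seqs q n. marginal SV (s, v))"
      unfolding mult_1_right by (intro sum_mono hsum)
    also have "\<dots> = 1"
      using sum_marginal[OF finite_SV SV_in, of "\<lambda>_. 1"]
      by (simp add: sum_weight sum.cartesian_product case_prod_unfold)
    finally show "sum ?Q ?\<Omega> \<le> sum P ?\<Omega>" by (simp add: sum_weight)
  next
    fix w assume w: "w \<in> ?\<Omega>" "0 < P w"
    have "0 < marginal SV (SV w)" using weight_le_marginal[OF w(1), of SV] w(2) by simp
    then show "0 < ?Q w" using q L by (simp add: SV_def V_def fano_kernel_pos)
  next
    fix w show "0 \<le> ?Q w" by (intro mult_nonneg_nonneg h_nonneg fano_kernel_nonneg)
  qed (rule weight_nonneg)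
  also have "(\<Sum>w\<in>?\<Omega>. P w * log 2 (P w)) = (\<Sum>w\<in>?\<Omega>. P w * (log 2 (state_weight lam n (snd w)) - log 2 ?L))"
    using L by (intro sum_cong_pos) (auto simp: P_def log_divide state_weight_pos)
  also have "\<dots> = log_S - log 2 ?L"
    by (simp add: log_S_def right_diff_distrib sum_subtractf sum_distrib_right[symmetric] sum_weight)
  finally have 1: "(\<Sum>w\<in>?\<Omega>. P w * log 2 (?Q w)) \<le> log_S - log 2 ?L" .
  have "(\<Sum>w\<in>?\<Omega>. P w * log 2 (?Q w)) = (\<Sum>w\<in>?\<Omega>. P w * (log 2 (marginal SV (SV w))
     - real (?off (snd w)) * log 2 q + (- 1 - of_bool (g (?x w) \<noteq> fst w) * log 2 ?L)))"
  proof (rule sum_cong_pos)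
    fix w assume w: "w \<in> ?\<Omega>" "0 < P w"
    have "0 < marginal SV (SV w)" using weight_le_marginal[OF w(1), of SV] w(2) by simp
    then show "log 2 (?Q w) = log 2 (marginal SV (SV w))
     - real (?off (snd w)) * log 2 q + (- 1 - of_bool (g (?x w) \<noteq> fst w) * log 2 ?L)"
      using q L by (simp add: SV_def V_def log_mult_pos log_divide_pos fano_kernel_pos
          log_fano_kernel log_nat_power)
  qed
  also have "\<dots> = log_SV - (\<Sum>w\<in>?\<Omega>. P w * real (?off (snd w))) * log 2 q - 1
      - (\<Sum>w\<in>?\<Omega>. P w * of_bool (g (?x w) \<noteq> fst w)) * log 2 ?L"
    unfolding log_SV_def
    by (simp only: right_diff_distrib distrib_left sum_subtractf sum.distrib sum_distrib_right
        mult.assoc mult_minus_right mult_1_right sum_negf sum_weight)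
  finally have "log_SV - n * (1 - lam) * log 2 q - 1
      - (\<Sum>w\<in>?\<Omega>. P w * of_bool (g (?x w) \<noteq> fst w)) * log 2 ?L \<le> log_S - log 2 ?L"
    using 1 by (simp only: sum_card_off)
  moreover have "(\<Sum>w\<in>?\<Omega>. P w * of_bool (g (?x w) \<noteq> fst w)) * log 2 ?L \<le> e * log 2 ?L"
    using err L by (intro mult_right_mono) auto
  ultimately show ?thesis by (simp add: left_diff_distrib)
qed

text \<open>The noise is independent of this message, so the true weight of a pair is the product
  \<open>?P\<close>. Translation by a codeword is injective, so \<open>?Q\<close> may treat the
  output as uniform on all \<open>q^n\<close> sequences and guess the message by the Fano
  kernel.\<close>

lemma message2_bound:
  fixes g :: "(nat \<Rightarrow> nat) \<Rightarrow> nat"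
  assumes M': "finite M'" "M' \<noteq> {}"
    and err: "(\<Sum>m\<in>M'. \<Sum>w\<in>M \<times> state_seqs n.
      P w / card M' * of_bool (g (seq_add q n (x' m) (V w)) \<noteq> m)) \<le> e"
  shows "(1 - e) * log 2 (card M') \<le> n * log 2 q + log_V + 1"
proof -
  let ?\<Omega> = "M \<times> state_seqs n" and ?L = "card M'" and ?X = "symbol_seqs q n"
  let ?k = "fano_kernel g ?L"
  let ?y = "\<lambda>z. seq_add q n (x' (fst z)) (snd z)"
  let ?P = "\<lambda>z. marginal V (snd z) / ?L"
  let ?Q = "\<lambda>z. ?k (fst z) (?y z) / real q ^ n"
  have L: "0 < ?L" using M' by (simp add: card_gt_0_iff)
  have V_sub: "V ` ?\<Omega> \<subseteq> ?X" using V_in by auto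
  note sumV = sum_marginal[OF finite_symbol_seqs V_sub]
  have sum1: "(\<Sum>z\<in>M' \<times> ?X. ?P z) = 1"
  proof -
    have "(\<Sum>z\<in>M' \<times> ?X. ?P z) = (\<Sum>m\<in>M'. \<Sum>v\<in>?X. marginal V v / ?L)"
      by (simp only: sum.cartesian_product case_prod_unfold)
    then show ?thesis
      using L sumV[of "\<lambda>_. 1"] by (simp add: sum_divide_distrib[symmetric] sum_weight)
  qed
  have "(\<Sum>z\<in>M' \<times> ?X. ?P z * log 2 (?Q z)) \<le> (\<Sum>z\<in>M' \<times> ?X. ?P z * log 2 (?P z))"
  proof (rule gibbs_inequality)
    have "sum ?Q (M' \<times> ?X) = (\<Sum>m\<in>M'. \<Sum>v\<in>?X. ?k m (seq_add q n (x' m) v) / real q ^ n)"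
      by (simp add: sum.cartesian_product case_prod_unfold)
    also have "\<dots> = (\<Sum>m\<in>M'. \<Sum>y\<in>seq_add q n (x' m) ` ?X. ?k m y / real q ^ n)"
      by (subst sum.reindex[OF inj_seq_add_right]) simp
    also have "\<dots> \<le> (\<Sum>m\<in>M'. \<Sum>y\<in>?X. ?k m y / real q ^ n)"
      using q seq_add_in by (intro sum_mono sum_mono2)
        (auto simp: finite_symbol_seqs fano_kernel_nonneg)
    also have "\<dots> = (\<Sum>y\<in>?X. (\<Sum>m\<in>M'. ?k m y) / real q ^ n)"
      by (subst sum.swap) (simp add: sum_divide_distrib)
    also have "\<dots> \<le> (\<Sum>y\<in>?X. 1 / real q ^ n)"
      using M' L by (intro sum_mono divide_right_mono sum_fano_kernel_le) auto
    also have "\<dots> = 1" using q by (simp add: symbol_seqs_def card_PiE)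
    finally show "sum ?Q (M' \<times> ?X) \<le> sum ?P (M' \<times> ?X)" using sum1 by simp
  next
    show "finite (M' \<times> ?X)" using M' by (simp add: finite_symbol_seqs)
  next
    fix z :: "nat \<times> (nat \<Rightarrow> nat)"
    show "0 \<le> ?P z" using marginal_nonneg by (intro divide_nonneg_nonneg) auto
    show "0 \<le> ?Q z" by (intro divide_nonneg_nonneg fano_kernel_nonneg) auto
    show "0 < ?Q z" using q L by (intro divide_pos_pos fano_kernel_pos) auto
  qed
  also have "(\<Sum>z\<in>M' \<times> ?X. ?P z * log 2 (?P z))
     = (\<Sum>m\<in>M'. \<Sum>v\<in>?X. marginal V v * (log 2 (marginal V v / ?L) / ?L))"
    by (subst sum.cartesian_product) (simp add: case_prod_unfold)
  also have "\<dots> = (\<Sum>w\<in>?\<Omega>. P w * log 2 (marginal V (V w) / ?L))"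
    using L by (simp only: sumV) (simp add: sum_divide_distrib[symmetric])
  also have "\<dots> = (\<Sum>w\<in>?\<Omega>. P w * (log 2 (marginal V (V w)) - log 2 ?L))"
  proof (rule sum_cong_pos)
    fix w assume w: "w \<in> ?\<Omega>" "0 < P w"
    have "0 < marginal V (V w)" using weight_le_marginal[OF w(1), of V] w(2) by simp
    then show "log 2 (marginal V (V w) / ?L) = log 2 (marginal V (V w)) - log 2 ?L"
      using L by (simp add: log_divide_pos)
  qed
  also have "\<dots> = log_V - log 2 ?L"
    by (simp add: log_V_def right_diff_distrib sum_subtractf sum_distrib_right[symmetric] sum_weight)
  finally have 1: "(\<Sum>z\<in>M' \<times> ?X. ?P z * log 2 (?Q z)) \<le> log_V - log 2 ?L" .
  have "(\<Sum>z\<in>M' \<times> ?X. ?P z * log 2 (?Q z))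
     = (\<Sum>z\<in>M' \<times> ?X. ?P z * (- 1 - n * log 2 q) - ?P z * of_bool (g (?y z) \<noteq> fst z) * log 2 ?L)"
    using q L by (intro sum.cong refl)
      (simp add: log_divide_pos fano_kernel_pos log_fano_kernel log_nat_power field_simps)
  also have "\<dots> = - 1 - n * log 2 q
      - (\<Sum>z\<in>M' \<times> ?X. ?P z * of_bool (g (?y z) \<noteq> fst z)) * log 2 ?L"
    by (simp only: sum_subtractf sum_distrib_right[symmetric] sum1) simp
  also have "(\<Sum>z\<in>M' \<times> ?X. ?P z * of_bool (g (?y z) \<noteq> fst z))
     = (\<Sum>m\<in>M'. \<Sum>v\<in>?X. marginal V v * (of_bool (g (seq_add q n (x' m) v) \<noteq> m) / ?L))"
    by (simp add: sum.cartesian_product case_prod_unfold)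
  also have "\<dots> = (\<Sum>m\<in>M'. \<Sum>w\<in>?\<Omega>. P w / card M' * of_bool (g (seq_add q n (x' m) (V w)) \<noteq> m))"
    by (simp only: sumV) simp
  finally have "- 1 - n * log 2 q
      - (\<Sum>m\<in>M'. \<Sum>w\<in>?\<Omega>. P w / card M' * of_bool (g (seq_add q n (x' m) (V w)) \<noteq> m)) * log 2 ?L
      \<le> log_V - log 2 ?L"
    using 1 by simp
  moreover have "(\<Sum>m\<in>M'. \<Sum>w\<in>?\<Omega>. P w / card M' * of_bool (g (seq_add q n (x' m) (V w)) \<noteq> m)) * log 2 ?L
      \<le> e * log 2 ?L"
    using err L by (intro mult_right_mono) auto
  ultimately show ?thesis by (simp add: left_diff_distrib)
qed

end

section \<open>Single-letterization by time sharing\<close>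

definition rate_pairs :: "nat \<Rightarrow> real \<Rightarrow> (real \<times> real) set" where
  "rate_pairs q lam = (\<lambda>p. (rate_bound1 q lam p, rate_bound2 q lam p)) ` prob_simplex q"

lemma state_mix_delta0: "state_mix lam delta0 = delta0"
  by (auto simp: state_mix_def algebra_simps)

lemma entropy_delta0: "shannon_entropy q delta0 = 0"
  by (auto simp: shannon_entropy_def delta0_def intro!: sum.neutral)

text \<open>Encoder 1 sends 0 whenever the state is 1, so receiver 2 sees no noise at all.\<close>

lemma rate_pair_delta0:
  "0 < q \<Longrightarrow> ((1 - lam) * log 2 (real q), log 2 (real q)) \<in> rate_pairs q lam"
  unfolding rate_pairs_def
  by (rule image_eqI[of _ _ delta0])
    (auto simp: rate_bound1_def rate_bound2_def state_mix_delta0 entropy_delta0 delta0_simplex)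

text \<open>Here \<open>a\<close> plays the role of \<open>H(V\<^sup>n|S\<^sup>n)\<close> and \<open>h\<close> that of \<open>H(V\<^sup>n)\<close>. When \<open>a\<close> falls short of
  \<open>\<Sum>\<^sub>i H(V\<^sub>i|S\<^sub>i)\<close>, the average of the letter laws is time-shared with the silent law \<open>delta0\<close>.\<close>

lemma hull_dominates:
  fixes q n :: nat and lam :: real
  assumes q: "0 < q" and n: "0 < n" and lam: "0 \<le> lam" "lam \<le> 1"
    and p: "\<And>i. i \<in> {1..n} \<Longrightarrow> p i \<in> prob_simplex q"
    and X: "X = (\<Sum>i\<in>{1..n}. lam * shannon_entropy q (p i))"
    and Y: "Y = (\<Sum>i\<in>{1..n}. shannon_entropy q (state_mix lam (p i)))"
    and a: "a \<le> X" "a \<le> h + X - Y" and h: "0 \<le> h"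
  shows "\<exists>(U, W) \<in> convex hull rate_pairs q lam.
    a + n * (1 - lam) * log 2 q \<le> n * U \<and> n * log 2 q - h \<le> n * W"
proof (cases "a \<le> 0")
  case True
  \<comment> \<open>The silent law alone dominates, as \<open>a\<close> is not positive and
    \<open>h\<close> is nonnegative.\<close>
  show ?thesis
    by (rule bexI[OF _ hull_inc[OF rate_pair_delta0[OF q]]]) (use True h in \<open>simp add: mult.assoc\<close>)
next
  case False
  \<comment> \<open>This weight makes the first coordinate of the mixture match exactly:
    \<open>\<theta> * X = a\<close>.\<close>
  define \<theta> where "\<theta> = a / X"
  have th: "0 \<le> \<theta>" "\<theta> \<le> 1" "\<theta> * X = a" using False a by (auto simp: \<theta>_def)
  let ?z = "\<lambda>i. (rate_bound1 q lam (p i), rate_bound2 q lam (p i))"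
  let ?c = "((1 - lam) * log 2 (real q), log 2 (real q))"
  let ?zm = "\<Sum>i\<in>{1..n}. (1 / real n) *\<^sub>R ?z i"
  have "?zm \<in> convex hull rate_pairs q lam"
    using n p by (intro convex_sum convex_convex_hull hull_inc) (auto simp: rate_pairs_def)
  then have mem: "\<theta> *\<^sub>R ?zm + (1 - \<theta>) *\<^sub>R ?c \<in> convex hull rate_pairs q lam"
    using th hull_inc[OF rate_pair_delta0[OF q]]
    by (intro convexD[OF convex_convex_hull]) auto
  \<comment> \<open>The second coordinate follows from \<open>\<theta> * Y = a + \<theta> * (Y - X)
    \<le> h + (1 - \<theta>) * (X - Y) \<le> h\<close>.\<close>
  have "X \<le> Y" unfolding X Y using p q lam by (intro sum_mono entropy_state_mix_ge) auto
  then have "(1 - \<theta>) * (X - Y) \<le> 0" using th by (intro mult_nonneg_nonpos) auto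
  then have Yh: "\<theta> * Y \<le> h" using th a by (simp add: algebra_simps)
  have zm: "n * fst ?zm = n * (1 - lam) * log 2 q + X" "n * snd ?zm = n * log 2 q - Y"
    using n by (simp_all add: fst_sum snd_sum X Y rate_bound1_def rate_bound2_def sum.distrib
        sum_subtractf sum_divide_distrib[symmetric] sum_distrib_left[symmetric])
  have "n * fst (\<theta> *\<^sub>R ?zm + (1 - \<theta>) *\<^sub>R ?c)
      = \<theta> * (n * fst ?zm) + (1 - \<theta>) * (n * (1 - lam) * log 2 q)" by (simp add: algebra_simps)
  also have "\<dots> = a + n * (1 - lam) * log 2 q" unfolding zm th(3)[symmetric] by (simp add: algebra_simps)
  finally have 1: "n * fst (\<theta> *\<^sub>R ?zm + (1 - \<theta>) *\<^sub>R ?c) = a + n * (1 - lam) * log 2 q" .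
  have "n * snd (\<theta> *\<^sub>R ?zm + (1 - \<theta>) *\<^sub>R ?c)
      = \<theta> * (n * snd ?zm) + (1 - \<theta>) * (n * log 2 q)" by (simp add: algebra_simps)
  also have "\<dots> = n * log 2 q - \<theta> * Y" unfolding zm by (simp add: algebra_simps)
  finally have 2: "n * snd (\<theta> *\<^sub>R ?zm + (1 - \<theta>) *\<^sub>R ?c) = n * log 2 q - \<theta> * Y" .
  show ?thesis
    by (rule bexI[OF _ mem]) (use 1 2 Yh in \<open>simp add: case_prod_unfold\<close>)
qed

text \<open>In both bounds the inner \<open>- 1\<close> is the bit lost by rounding the number of
  messages and the outer one is the constant of the Fano kernel.\<close>

lemma code_converse:
  fixes q n :: nat and lam R1 R2 \<epsilon> :: real
  assumes q: "0 < q" and n: "0 < n" and lam: "0 \<le> lam" "lam \<le> 1"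
    and R: "0 \<le> R1" "0 \<le> R2" and e: "\<epsilon> \<le> 1"
    and code: "is_code q lam n R1 R2 \<epsilon> f1 f2 g1 g2"
  shows "\<exists>(U, W) \<in> convex hull rate_pairs q lam.
    (1 - \<epsilon>) * (n * R1 - 1) - 1 \<le> n * U \<and> (1 - \<epsilon>) * (n * R2 - 1) - 1 \<le> n * W"
proof -
  let ?M1 = "messages n R1" and ?M2 = "messages n R2" and ?x = "\<lambda>m s. received1 n f1 m s"
  have ne: "?M1 \<noteq> {}" "?M2 \<noteq> {}" using one_in_messages[OF R(1)] one_in_messages[OF R(2)] by auto
  interpret z_encoder q n lam ?M1 ?x
    by standard (use q lam ne code in \<open>auto simp: finite_messages is_code_def received1_def
        channel_out1_def symbol_seqs_def\<close>)
  note L2 = card_messages_pos[OF R(2), of n]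
  have "(\<Sum>w\<in>?M1 \<times> state_seqs n. P w * of_bool (g1 (?x (fst w) (snd w)) \<noteq> fst w)) \<le> \<epsilon>"
  proof -
    have "measure_pmf.prob (source_pmf lam n R1 R2) {(m1, m2, s). g1 (?x m1 s) \<noteq> m1} \<le> \<epsilon>"
      using code by (simp add: is_code_def)
    then show ?thesis
      unfolding source_prob_eq[OF R lam, of n "\<lambda>m1 m2 s. g1 (?x m1 s) \<noteq> m1"] sum_P
      using L2 by (simp add: sum_distrib_left)
  qed
  note b1 = message1_bound[OF this]
  have nv: "noise n s (\<lambda>i. f1 i m s) = V (m, s)" for m s
    by (simp only: V_def fst_conv snd_conv) (auto simp: noise_def received1_def channel_out1_def)
  have "(\<Sum>m\<in>?M2. \<Sum>w\<in>?M1 \<times> state_seqs n.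
      P w / card ?M2 * of_bool (g2 (seq_add q n (\<lambda>i. f2 i m) (V w)) \<noteq> m)) \<le> \<epsilon>"
  proof -
    have "measure_pmf.prob (source_pmf lam n R1 R2)
        {(m1, m2, s). g2 (received2 q n f1 f2 m1 m2 s) \<noteq> m2} \<le> \<epsilon>"
      using code by (simp add: is_code_def)
    then have "(\<Sum>m1\<in>?M1. \<Sum>m2\<in>?M2. \<Sum>s\<in>state_seqs n. state_weight lam n s / (card ?M1 * card ?M2)
       * of_bool (g2 (seq_add q n (\<lambda>i. f2 i m2) (V (m1, s))) \<noteq> m2)) \<le> \<epsilon>"
      unfolding source_prob_eq[OF R lam, of n "\<lambda>m1 m2 s. g2 (received2 q n f1 f2 m1 m2 s) \<noteq> m2"]
      by (simp only: received2_eq nv)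
    then show ?thesis
      by (subst (asm) sum.swap) (simp add: P_def sum.cartesian_product case_prod_unfold)
  qed
  note b2 = message2_bound[OF finite_messages ne(2) this]
  obtain U W :: real where UW: "(U, W) \<in> convex hull rate_pairs q lam"
    "(log_S - log_SV) + n * (1 - lam) * log 2 q \<le> n * U" "n * log 2 q - (- log_V) \<le> n * W"
    using hull_dominates[OF q n lam input_law_simplex refl refl conditional_noise_entropy_le,
        of "- log_V"] noise_information_ge log_V_nonpos
    by (auto simp: sum_subtractf)
  have "(1 - \<epsilon>) * (n * R1 - 1) \<le> (1 - \<epsilon>) * log 2 (card ?M1)"
    "(1 - \<epsilon>) * (n * R2 - 1) \<le> (1 - \<epsilon>) * log 2 (card ?M2)"
    using e log_card_messages_ge R by (intro mult_left_mono; simp)+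
  then have "(1 - \<epsilon>) * (n * R1 - 1) - 1 \<le> n * U" "(1 - \<epsilon>) * (n * R2 - 1) - 1 \<le> n * W"
    using b1 b2 UW by linarith+
  then show ?thesis using UW(1) by blast
qed

section \<open>Binning, codebooks and concentration\<close>

text \<open>Points admitting such a schedule form a convex set. \<open>F\<close> and
  \<open>K\<close> are independent of \<open>n\<close>; finiteness of \<open>F\<close> later yields
  one variance bound for all letters.\<close>

lemma convex_hull_schedule:
  fixes f :: "'p \<Rightarrow> 'v::real_normed_vector"
  assumes "z \<in> convex hull (f ` S)"
  obtains F K where "finite F" "F \<subseteq> S"
    "\<And>n. \<exists>c. (\<forall>i\<in>{1..n}. c i \<in> F) \<and> norm ((\<Sum>i\<in>{1..n}. f (c i)) - real n *\<^sub>R z) \<le> K"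
proof -
  define sched where "sched F K z \<longleftrightarrow>
    (\<forall>n. \<exists>c. (\<forall>i\<in>{1..n}. c i \<in> F) \<and> norm ((\<Sum>i\<in>{1..n}. f (c i)) - real n *\<^sub>R z) \<le> K)" for F K z
  define A where "A = {z. \<exists>F K. finite F \<and> F \<subseteq> S \<and> sched F K z}"
  have base: "f ` S \<subseteq> A"
  proof
    fix z assume "z \<in> f ` S"
    then obtain p where "p \<in> S" "z = f p" by auto
    then have "sched {p} 0 z"
      unfolding sched_def by (intro allI exI[of _ "\<lambda>_. p"]) (simp add: sum_constant_scaleR)
    with \<open>p \<in> S\<close> show "z \<in> A" unfolding A_def by (intro CollectI exI[of _ "{p}"] exI[of _ 0]) simp
  qed
  have "convex A"
  proof (rule convexI)
    fix y z :: 'v and u v :: real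
    assume yz: "y \<in> A" "z \<in> A" and uv: "0 \<le> u" "0 \<le> v" "u + v = 1"
    obtain F1 K1 F2 K2 where F: "finite F1" "F1 \<subseteq> S" "sched F1 K1 y" "finite F2" "F2 \<subseteq> S" "sched F2 K2 z"
      using yz unfolding A_def by blast
    have "sched (F1 \<union> F2) (K1 + K2 + norm (y - z)) (u *\<^sub>R y + v *\<^sub>R z)"
      unfolding sched_def
    proof
      fix n :: nat
      \<comment> \<open>The first \<open>k\<close> uses follow the schedule of \<open>y\<close> and
        the rest that of \<open>z\<close>; rounding \<open>u * n\<close> shifts the sum by at most
        \<open>norm (y - z)\<close>.\<close>
      define k where "k = nat \<lfloor>u * n\<rfloor>"
      have k: "k \<le> n" "\<bar>real k - u * n\<bar> \<le> 1"
      proof -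
        have "u * n \<le> 1 * real n" using uv by (intro mult_right_mono) auto
        moreover have "0 \<le> u * n" using uv by simp
        ultimately show "k \<le> n" "\<bar>real k - u * n\<bar> \<le> 1" unfolding k_def by linarith+
      qed
      obtain c1 where c1: "\<forall>i\<in>{1..k}. c1 i \<in> F1" "norm ((\<Sum>i\<in>{1..k}. f (c1 i)) - real k *\<^sub>R y) \<le> K1"
        using F(3) unfolding sched_def by blast
      obtain c2 where c2: "\<forall>i\<in>{1..n-k}. c2 i \<in> F2"
        "norm ((\<Sum>i\<in>{1..n-k}. f (c2 i)) - real (n - k) *\<^sub>R z) \<le> K2"
        using F(6) unfolding sched_def by blast
      let ?c = "\<lambda>i. if i \<le> k then c1 i else c2 (i - k)"
      have "(\<Sum>i\<in>{1..n}. f (?c i)) = (\<Sum>i\<in>{1..k}. f (?c i)) + (\<Sum>i\<in>{k+1..n}. f (?c i))"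
      proof -
        have "{1..n} = {1..k} \<union> {k+1..n}" using k(1) by auto
        then show ?thesis by (simp only:) (rule sum.union_disjoint, auto)
      qed
      also have "(\<Sum>i\<in>{k+1..n}. f (?c i)) = (\<Sum>i\<in>{1..n-k}. f (c2 i))"
        by (rule sum.reindex_bij_witness[of _ "\<lambda>i. i + k" "\<lambda>i. i - k"]) auto
      finally have s: "(\<Sum>i\<in>{1..n}. f (?c i)) = (\<Sum>i\<in>{1..k}. f (c1 i)) + (\<Sum>i\<in>{1..n-k}. f (c2 i))"
        by simp
      have "(\<Sum>i\<in>{1..n}. f (?c i)) - real n *\<^sub>R (u *\<^sub>R y + v *\<^sub>R z)
        = ((\<Sum>i\<in>{1..k}. f (c1 i)) - real k *\<^sub>R y)
          + ((\<Sum>i\<in>{1..n-k}. f (c2 i)) - real (n - k) *\<^sub>R z) + (real k - u * n) *\<^sub>R (y - z)"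
      proof -
        have v: "v = 1 - u" using uv by simp
        show ?thesis unfolding s v of_nat_diff[OF k(1)] by (simp add: algebra_simps)
      qed
      also have "norm \<dots> \<le> norm ((\<Sum>i\<in>{1..k}. f (c1 i)) - real k *\<^sub>R y)
          + norm ((\<Sum>i\<in>{1..n-k}. f (c2 i)) - real (n - k) *\<^sub>R z) + norm ((real k - u * n) *\<^sub>R (y - z))"
        by (intro norm_triangle_mono order_refl)
      also have "\<dots> \<le> K1 + K2 + norm (y - z)"
        using c1 c2 k(2) mult_right_mono[of "\<bar>real k - u * n\<bar>" 1 "norm (y - z)"] by simp
      finally have "norm ((\<Sum>i\<in>{1..n}. f (?c i)) - real n *\<^sub>R (u *\<^sub>R y + v *\<^sub>R z)) \<le> K1 + K2 + norm (y - z)" .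
      moreover have "\<forall>i\<in>{1..n}. ?c i \<in> F1 \<union> F2"
      proof
        fix i assume "i \<in> {1..n}"
        then show "?c i \<in> F1 \<union> F2"
          using c1(1) bspec[OF c2(1), of "i - k"] by (cases "i \<le> k") (auto simp: diff_le_mono)
      qed
      ultimately show "\<exists>c. (\<forall>i\<in>{1..n}. c i \<in> F1 \<union> F2) \<and>
          norm ((\<Sum>i\<in>{1..n}. f (c i)) - real n *\<^sub>R (u *\<^sub>R y + v *\<^sub>R z)) \<le> K1 + K2 + norm (y - z)"
        by (intro exI[of _ ?c]) blast
    qed
    with F show "u *\<^sub>R y + v *\<^sub>R z \<in> A" unfolding A_def by blast
  qed
  with base have "convex hull (f ` S) \<subseteq> A" by (rule hull_minimal)
  with assms obtain F K where "finite F" "F \<subseteq> S" "sched F K z" unfolding A_def by blast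
  then show ?thesis using that unfolding sched_def by blast
qed

lemma exists_le_average:
  fixes f :: "'a \<Rightarrow> real" and t :: real
  assumes "finite M" "M \<noteq> {}" "(\<Sum>c\<in>M. f c) \<le> card M * t"
  shows "\<exists>c\<in>M. f c \<le> t"
proof (rule ccontr)
  assume "\<not> ?thesis"
  then have "(\<Sum>c\<in>M. t) < (\<Sum>c\<in>M. f c)" using assms by (intro sum_strict_mono) auto
  with assms show False by simp
qed

text \<open>Colouring the points of \<open>D\<close> one at a time, each time with a colour that does not exceed the
  average, derandomizes a uniformly random colouring.\<close>

lemma exists_binning:
  fixes w :: "'s \<Rightarrow> 'm \<Rightarrow> real"
  assumes "finite D" "finite S" and M: "finite M" "M \<noteq> {}"
    and w: "\<And>s m. 0 \<le> w s m"
  shows "\<exists>g\<in>D \<rightarrow> M. (\<Sum>s\<in>S. \<Sum>m\<in>M. w s m * of_bool (\<forall>x\<in>A s \<inter> D. g x \<noteq> m))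
    \<le> (\<Sum>s\<in>S. \<Sum>m\<in>M. w s m * (1 - 1 / card M) ^ card (A s \<inter> D))"
  using \<open>finite D\<close> w
proof (induction D arbitrary: w rule: finite_induct)
  case empty
  then show ?case by simp
next
  case (insert x D)
  let ?r = "1 - 1 / real (card M)"
  \<comment> \<open>Once \<open>x\<close> has colour \<open>c\<close>, a pair \<open>(s, m)\<close>
    that \<open>x\<close> serves can no longer fail and gets weight 0. The induction hypothesis is
    applied to these reduced weights, which is why \<open>w\<close> is generalized.\<close>
  let ?w = "\<lambda>c s m. w s m * of_bool (x \<in> A s \<longrightarrow> m \<noteq> c)"
  have L: "0 < card M" using M by (simp add: card_gt_0_iff)
  have "(\<Sum>c\<in>M. \<Sum>s\<in>S. \<Sum>m\<in>M. ?w c s m * ?r ^ card (A s \<inter> D))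
      = (\<Sum>s\<in>S. \<Sum>m\<in>M. \<Sum>c\<in>M. ?w c s m * ?r ^ card (A s \<inter> D))"
    by (subst sum.swap, rule sum.cong[OF refl], rule sum.swap)
  also have "\<dots> = (\<Sum>s\<in>S. \<Sum>m\<in>M. card M * (w s m * ?r ^ card (A s \<inter> insert x D)))"
  proof (intro sum.cong refl)
    fix s m assume m: "m \<in> M"
    \<comment> \<open>If \<open>x\<close> lies in \<open>A s\<close>, exactly one colour serves
      \<open>m\<close>; averaging over colours thus produces the factor
      \<open>1 - 1 / card M\<close>.\<close>
    have "(\<Sum>c\<in>M. of_bool (x \<in> A s \<longrightarrow> m \<noteq> c)) = (if x \<in> A s then real (card M) - 1 else card M)"
    proof (cases "x \<in> A s")
      case True
      have "(\<Sum>c\<in>M. of_bool (m \<noteq> c)) = (\<Sum>c\<in>M. (1::real) - (if c = m then 1 else 0))"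
        by (intro sum.cong) auto
      also have "\<dots> = real (card M) - 1" using M m by (simp add: sum_subtractf sum.delta)
      finally show ?thesis using True by simp
    qed simp
    then have eq: "(\<Sum>c\<in>M. ?w c s m * ?r ^ card (A s \<inter> D))
       = w s m * (if x \<in> A s then real (card M) - 1 else card M) * ?r ^ card (A s \<inter> D)"
      by (simp only: sum_distrib_right[symmetric] sum_distrib_left[symmetric])
    have "card (A s \<inter> insert x D) = (if x \<in> A s then Suc (card (A s \<inter> D)) else card (A s \<inter> D))"
      using insert.hyps by (simp add: Int_insert_right)
    then show "(\<Sum>c\<in>M. ?w c s m * ?r ^ card (A s \<inter> D))
       = card M * (w s m * ?r ^ card (A s \<inter> insert x D))"
      unfolding eq using L by (auto simp: field_simps)
  qed
  also have "\<dots> = card M * (\<Sum>s\<in>S. \<Sum>m\<in>M. w s m * ?r ^ card (A s \<inter> insert x D))"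
    by (simp only: sum_distrib_left)
  finally obtain c where c: "c \<in> M" "(\<Sum>s\<in>S. \<Sum>m\<in>M. ?w c s m * ?r ^ card (A s \<inter> D))
      \<le> (\<Sum>s\<in>S. \<Sum>m\<in>M. w s m * ?r ^ card (A s \<inter> insert x D))"
    using exists_le_average[OF M eq_refl] by blast
  obtain g where g: "g \<in> D \<rightarrow> M" "(\<Sum>s\<in>S. \<Sum>m\<in>M. ?w c s m * of_bool (\<forall>x\<in>A s \<inter> D. g x \<noteq> m))
      \<le> (\<Sum>s\<in>S. \<Sum>m\<in>M. ?w c s m * ?r ^ card (A s \<inter> D))"
    using insert.IH[of "?w c"] insert.prems by auto
  let ?g = "g(x := c)"
  have "(\<Sum>s\<in>S. \<Sum>m\<in>M. w s m * of_bool (\<forall>y\<in>A s \<inter> insert x D. ?g y \<noteq> m))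
     = (\<Sum>s\<in>S. \<Sum>m\<in>M. ?w c s m * of_bool (\<forall>x\<in>A s \<inter> D. g x \<noteq> m))"
  proof (intro sum.cong refl)
    fix s m
    have "(\<forall>y\<in>A s \<inter> insert x D. ?g y \<noteq> m) \<longleftrightarrow> (x \<in> A s \<longrightarrow> m \<noteq> c) \<and> (\<forall>x\<in>A s \<inter> D. g x \<noteq> m)"
      using insert.hyps by (auto simp: Ball_def)
    then show "w s m * of_bool (\<forall>y\<in>A s \<inter> insert x D. ?g y \<noteq> m)
        = ?w c s m * of_bool (\<forall>x\<in>A s \<inter> D. g x \<noteq> m)"
      by (simp only: of_bool_conj mult.assoc)
  qed
  with g c have "(\<Sum>s\<in>S. \<Sum>m\<in>M. w s m * of_bool (\<forall>y\<in>A s \<inter> insert x D. ?g y \<noteq> m))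
      \<le> (\<Sum>s\<in>S. \<Sum>m\<in>M. w s m * ?r ^ card (A s \<inter> insert x D))" by linarith
  moreover have "?g \<in> insert x D \<rightarrow> M" using g(1) c(1) by auto
  ultimately show ?case by blast
qed

text \<open>A greedy choice: for each fixed noise at most \<open>j * card T\<close> of the
  \<open>q^n\<close> sequences shift it into the regions already taken, so some sequence meets the
  average. Only earlier codewords matter because the decoder takes the first hit.\<close>

lemma exists_codebook:
  fixes P :: "'w \<Rightarrow> real" and V :: "'w \<Rightarrow> nat \<Rightarrow> nat" and k :: nat
  assumes q: "0 < q" and \<Omega>: "finite \<Omega>" "\<And>w. w \<in> \<Omega> \<Longrightarrow> 0 \<le> P w" "sum P \<Omega> = 1"
    and T: "finite T"
  shows "\<exists>c. \<forall>j<k. c j \<in> symbol_seqs q n \<and>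
    (\<Sum>w\<in>\<Omega>. P w * of_bool (seq_add q n (c j) (V w) \<in> (\<Union>i<j. seq_add q n (c i) ` T)))
      \<le> j * card T / real q ^ n"
proof (induction k)
  case 0
  then show ?case by simp
next
  case (Suc k)
  then obtain c where c: "\<And>j. j < k \<Longrightarrow> c j \<in> symbol_seqs q n \<and>
    (\<Sum>w\<in>\<Omega>. P w * of_bool (seq_add q n (c j) (V w) \<in> (\<Union>i<j. seq_add q n (c i) ` T)))
      \<le> j * card T / real q ^ n" by blast
  let ?X = "symbol_seqs q n" and ?D = "\<Union>i<k. seq_add q n (c i) ` T"
  have cardX: "card ?X = q ^ n" by (simp add: symbol_seqs_def card_PiE)
  then have neX: "?X \<noteq> {}" using q by auto
  have "card ?D \<le> (\<Sum>i<k. card (seq_add q n (c i) ` T))" by (rule card_UN_le) simp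
  also have "\<dots> \<le> (\<Sum>i<k. card T)" by (intro sum_mono card_image_le T)
  finally have cardD: "card ?D \<le> k * card T" by simp
  have finD: "finite ?D" using T by simp
  have "(\<Sum>x\<in>?X. \<Sum>w\<in>\<Omega>. P w * of_bool (seq_add q n x (V w) \<in> ?D))
      = (\<Sum>w\<in>\<Omega>. P w * card {x \<in> ?X. seq_add q n x (V w) \<in> ?D})"
    by (subst sum.swap)
      (simp add: sum_distrib_left[symmetric] of_bool_def sum.If_cases finite_symbol_seqs Int_def)
  also have "\<dots> \<le> (\<Sum>w\<in>\<Omega>. P w * card ?D)"
  proof (intro sum_mono mult_left_mono)
    fix w
    have "card {x \<in> ?X. seq_add q n x (V w) \<in> ?D} \<le> card ?D"
      by (rule card_inj_on_le[of "\<lambda>x. seq_add q n x (V w)"])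
        (use finD in \<open>auto intro: inj_on_subset[OF inj_seq_add_left]\<close>)
    then show "real (card {x \<in> ?X. seq_add q n x (V w) \<in> ?D}) \<le> card ?D" by simp
  qed (use \<Omega> in auto)
  also have "\<dots> = card ?D" using \<Omega>(3) by (simp add: sum_distrib_right[symmetric])
  also have "\<dots> \<le> card ?X * (k * card T / real q ^ n)"
  proof -
    have "real (card ?D) \<le> real (k * card T)" using cardD by (simp only: of_nat_le_iff)
    then show ?thesis using q cardX by simp
  qed
  finally obtain x where x: "x \<in> ?X"
    "(\<Sum>w\<in>\<Omega>. P w * of_bool (seq_add q n x (V w) \<in> ?D)) \<le> k * card T / real q ^ n"
    using exists_le_average[OF finite_symbol_seqs neX] by blast
  have eq: "(\<Union>i<j. seq_add q n ((c(k := x)) i) ` T) = (\<Union>i<j. seq_add q n (c i) ` T)" if "j \<le> k" for j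
    using that by (intro SUP_cong) auto
  have "(c(k := x)) j \<in> ?X \<and>
    (\<Sum>w\<in>\<Omega>. P w * of_bool (seq_add q n ((c(k := x)) j) (V w)
        \<in> (\<Union>i<j. seq_add q n ((c(k := x)) i) ` T)))
      \<le> j * card T / real q ^ n" if "j < Suc k" for j
    using that x c[of j] by (subst eq) (auto simp: less_Suc_eq)
  then show ?case by blast
qed

text \<open>Under product weights the cross terms factor and vanish, each \<open>f i\<close> being
  centred; only the diagonal remains.\<close>

lemma product_second_moment:
  fixes w f :: "'i \<Rightarrow> 'a \<Rightarrow> real"
  assumes I: "finite I" and B: "finite B"
    and w: "\<And>i. i \<in> I \<Longrightarrow> (\<Sum>a\<in>B. w i a) = 1"
    and f: "\<And>i. i \<in> I \<Longrightarrow> (\<Sum>a\<in>B. w i a * f i a) = 0"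
  shows "(\<Sum>z\<in>I \<rightarrow>\<^sub>E B. (\<Prod>i\<in>I. w i (z i)) * (\<Sum>i\<in>I. f i (z i))\<^sup>2)
    = (\<Sum>i\<in>I. \<Sum>a\<in>B. w i a * (f i a)\<^sup>2)"
proof -
  have cross: "(\<Sum>z\<in>I \<rightarrow>\<^sub>E B. (\<Prod>k\<in>I. w k (z k)) * (f i (z i) * f j (z j)))
      = (if i = j then \<Sum>a\<in>B. w i a * (f i a)\<^sup>2 else 0)" if ij: "i \<in> I" "j \<in> I" for i j
  proof -
    let ?h = "\<lambda>k a. w k a * ((if k = i then f k a else 1) * (if k = j then f k a else 1))"
    have "(\<Sum>z\<in>I \<rightarrow>\<^sub>E B. (\<Prod>k\<in>I. w k (z k)) * (f i (z i) * f j (z j)))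
        = (\<Sum>z\<in>I \<rightarrow>\<^sub>E B. \<Prod>k\<in>I. ?h k (z k))"
      using I ij by (intro sum.cong refl) (simp only: prod.distrib, simp add: prod.delta)
    also have "\<dots> = (\<Prod>k\<in>I. \<Sum>a\<in>B. ?h k a)"
      using I B by (subst prod_sum_PiE) auto
    also have "\<dots> = (if i = j then \<Sum>a\<in>B. w i a * (f i a)\<^sup>2 else 0)"
    proof (cases "i = j")
      case True
      have "(\<Prod>k\<in>I. \<Sum>a\<in>B. ?h k a) = (\<Prod>k\<in>I. if k = i then \<Sum>a\<in>B. w k a * (f k a)\<^sup>2 else 1)"
        using True w by (intro prod.cong) (auto simp: power2_eq_square)
      then show ?thesis using I ij True by (simp add: prod.delta)
    next
      case False
      have "(\<Sum>a\<in>B. ?h i a) = 0" using False f[OF ij(1)] by simp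
      then have "(\<Prod>k\<in>I. \<Sum>a\<in>B. ?h k a) = 0"
        using I ij by (intro prod_zero bexI[of _ i])
      then show ?thesis using False by (simp only: if_False)
    qed
    finally show ?thesis .
  qed
  have "(\<Sum>z\<in>I \<rightarrow>\<^sub>E B. (\<Prod>i\<in>I. w i (z i)) * (\<Sum>i\<in>I. f i (z i))\<^sup>2)
     = (\<Sum>i\<in>I. \<Sum>j\<in>I. \<Sum>z\<in>I \<rightarrow>\<^sub>E B. (\<Prod>k\<in>I. w k (z k)) * (f i (z i) * f j (z j)))"
  proof -
    have "(\<Prod>i\<in>I. w i (z i)) * (\<Sum>i\<in>I. f i (z i))\<^sup>2
        = (\<Sum>i\<in>I. \<Sum>j\<in>I. (\<Prod>k\<in>I. w k (z k)) * (f i (z i) * f j (z j)))" for z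
      by (simp only: power2_eq_square sum_product) (simp only: sum_distrib_left)
    then show ?thesis
      by (simp only:) (subst sum.swap, rule sum.cong[OF refl], rule sum.swap)
  qed
  also have "\<dots> = (\<Sum>i\<in>I. \<Sum>j\<in>I. if i = j then \<Sum>a\<in>B. w i a * (f i a)\<^sup>2 else 0)"
    by (intro sum.cong refl cross)
  also have "\<dots> = (\<Sum>i\<in>I. \<Sum>a\<in>B. w i a * (f i a)\<^sup>2)"
    using I by (simp add: sum.delta')
  finally show ?thesis .
qed

lemma product_chebyshev:
  fixes w f :: "'i \<Rightarrow> 'a \<Rightarrow> real" and C t :: real
  assumes I: "finite I" and B: "finite B"
    and w: "\<And>i. i \<in> I \<Longrightarrow> (\<Sum>a\<in>B. w i a) = 1" "\<And>i a. i \<in> I \<Longrightarrow> a \<in> B \<Longrightarrow> 0 \<le> w i a"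
    and f: "\<And>i. i \<in> I \<Longrightarrow> (\<Sum>a\<in>B. w i a * f i a) = 0"
    and var: "\<And>i. i \<in> I \<Longrightarrow> (\<Sum>a\<in>B. w i a * (f i a)\<^sup>2) \<le> C" and t: "0 < t"
  shows "(\<Sum>z\<in>I \<rightarrow>\<^sub>E B. (\<Prod>i\<in>I. w i (z i)) * of_bool (t < \<bar>\<Sum>i\<in>I. f i (z i)\<bar>)) \<le> card I * C / t\<^sup>2"
proof -
  have "(\<Sum>z\<in>I \<rightarrow>\<^sub>E B. (\<Prod>i\<in>I. w i (z i)) * of_bool (t < \<bar>\<Sum>i\<in>I. f i (z i)\<bar>))
      \<le> (\<Sum>z\<in>I \<rightarrow>\<^sub>E B. (\<Prod>i\<in>I. w i (z i)) * ((\<Sum>i\<in>I. f i (z i))\<^sup>2 / t\<^sup>2))"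
  proof (intro sum_mono mult_left_mono)
    fix z
    show "of_bool (t < \<bar>\<Sum>i\<in>I. f i (z i)\<bar>) \<le> (\<Sum>i\<in>I. f i (z i))\<^sup>2 / t\<^sup>2"
    proof (cases "t < \<bar>\<Sum>i\<in>I. f i (z i)\<bar>")
      case True
      then have "t\<^sup>2 \<le> (\<Sum>i\<in>I. f i (z i))\<^sup>2"
        using t by (subst abs_le_square_iff[symmetric]) simp
      then show ?thesis using True t by (simp add: le_divide_eq)
    qed simp
  qed (use w(2) in \<open>auto intro!: prod_nonneg\<close>)
  also have "\<dots> = (\<Sum>z\<in>I \<rightarrow>\<^sub>E B. (\<Prod>i\<in>I. w i (z i)) * (\<Sum>i\<in>I. f i (z i))\<^sup>2) / t\<^sup>2"
    by (simp add: sum_divide_distrib)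
  also have "\<dots> = (\<Sum>i\<in>I. \<Sum>a\<in>B. w i a * (f i a)\<^sup>2) / t\<^sup>2"
    by (simp only: product_second_moment[OF I B w(1) f])
  also have "\<dots> \<le> card I * C / t\<^sup>2"
    using sum_bounded_above[of I "\<lambda>i. \<Sum>a\<in>B. w i a * (f i a)\<^sup>2" C] var
    by (intro divide_right_mono) auto
  finally show ?thesis .
qed

section \<open>Achievability\<close>

text \<open>The random input behind the code: law \<open>p\<close> in state 1, uniform in state
  0.\<close>

definition input_kernel :: "nat \<Rightarrow> (nat \<Rightarrow> real) \<Rightarrow> bool \<Rightarrow> nat \<Rightarrow> real" where
  "input_kernel q p b x = (if b then p x else 1 / real q)"

definition letter_joint :: "nat \<Rightarrow> real \<Rightarrow> (nat \<Rightarrow> real) \<Rightarrow> bool \<times> nat \<Rightarrow> real" where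
  "letter_joint q lam p = (\<lambda>(b, x). (if b then lam else 1 - lam) * input_kernel q p b x)"

definition input_surprisal :: "nat \<Rightarrow> (nat \<Rightarrow> real) \<Rightarrow> bool \<times> nat \<Rightarrow> real" where
  "input_surprisal q p = (\<lambda>(b, x). - log 2 (input_kernel q p b x))"

definition noise_surprisal :: "real \<Rightarrow> (nat \<Rightarrow> real) \<Rightarrow> bool \<times> nat \<Rightarrow> real" where
  "noise_surprisal lam p = (\<lambda>(b, x). - log 2 (state_mix lam p (if b then x else 0)))"

definition letter_variance ::
    "nat \<Rightarrow> real \<Rightarrow> (nat \<Rightarrow> real) \<Rightarrow> (bool \<times> nat \<Rightarrow> real) \<Rightarrow> real \<Rightarrow> real" where
  "letter_variance q lam p f \<mu> = (\<Sum>a\<in>UNIV \<times> {..<q}. letter_joint q lam p a * (f a - \<mu>)\<^sup>2)"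

lemma sum_letter_joint:
  "(\<Sum>a\<in>UNIV \<times> {..<q}. letter_joint q lam p a * F a)
    = lam * (\<Sum>x<q. p x * F (True, x)) + (1 - lam) * ((\<Sum>x<q. F (False, x)) / q)"
proof -
  have "(\<Sum>a\<in>UNIV \<times> {..<q}. letter_joint q lam p a * F a)
      = (\<Sum>b\<in>UNIV. \<Sum>x<q. letter_joint q lam p (b, x) * F (b, x))"
    by (simp add: sum.cartesian_product)
  also have "\<dots> = lam * (\<Sum>x<q. p x * F (True, x)) + (1 - lam) * ((\<Sum>x<q. F (False, x)) / q)"
    by (simp add: UNIV_bool letter_joint_def input_kernel_def sum_distrib_left sum_divide_distrib
        mult.assoc)
  finally show ?thesis .
qed

lemma sum_letter_joint_1:
  "p \<in> prob_simplex q \<Longrightarrow> 0 < q \<Longrightarrow> (\<Sum>a\<in>UNIV \<times> {..<q}. letter_joint q lam p a) = 1"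
  using sum_letter_joint[of q lam p "\<lambda>_. 1"] by (simp add: prob_simplex_def)

lemma letter_joint_nonneg:
  "p \<in> prob_simplex q \<Longrightarrow> 0 \<le> lam \<Longrightarrow> lam \<le> 1 \<Longrightarrow> a \<in> UNIV \<times> {..<q} \<Longrightarrow> 0 \<le> letter_joint q lam p a"
  by (auto simp: letter_joint_def input_kernel_def prob_simplex_def)

text \<open>This identifies the first rate bound as \<open>H(X|S)\<close> for an input drawn from
  \<open>input_kernel\<close>.\<close>

lemma mean_input_surprisal:
  assumes "0 < q"
  shows "(\<Sum>a\<in>UNIV \<times> {..<q}. letter_joint q lam p a * input_surprisal q p a) = rate_bound1 q lam p"
  using assms by (simp add: sum_letter_joint input_surprisal_def input_kernel_def rate_bound1_def
      shannon_entropy_def sum_negf log_divide)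

lemma mean_noise_surprisal:
  assumes "0 < q"
  shows "(\<Sum>a\<in>UNIV \<times> {..<q}. letter_joint q lam p a * noise_surprisal lam p a)
    = shannon_entropy q (state_mix lam p)"
  using assms by (simp add: sum_letter_joint noise_surprisal_def
      shannon_entropy_def sum_negf sum_state_mix)

lemma centered_mean:
  assumes "p \<in> prob_simplex q" "0 < q"
    "(\<Sum>a\<in>UNIV \<times> {..<q}. letter_joint q lam p a * f a) = \<mu>"
  shows "(\<Sum>a\<in>UNIV \<times> {..<q}. letter_joint q lam p a * (f a - \<mu>)) = 0"
  using assms sum_letter_joint_1[OF assms(1,2), of lam]
  by (simp add: right_diff_distrib sum_subtractf sum_distrib_right[symmetric])

text \<open>Chebyshev's inequality is applied to sequences of pairs \<open>(S_i, X_i)\<close>, while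
  the code needs inputs counted for a fixed state sequence.\<close>

lemma sum_pair_seqs:
  "(\<Sum>z\<in>{1..n} \<rightarrow>\<^sub>E UNIV \<times> {..<q}. G z)
    = (\<Sum>s\<in>state_seqs n. \<Sum>x\<in>symbol_seqs q n. G (\<lambda>i\<in>{1..n}. (s i, x i)))"
proof -
  have unzip: "(\<lambda>i\<in>{1..n}. ((\<lambda>i\<in>{1..n}. fst (z i)) i, (\<lambda>i\<in>{1..n}. snd (z i)) i)) = z"
    if "z \<in> {1..n} \<rightarrow>\<^sub>E UNIV \<times> {..<q}" for z :: "nat \<Rightarrow> bool \<times> nat"
    using that by (auto simp: fun_eq_iff PiE_def extensional_def)
  show ?thesis
    unfolding sum.cartesian_product
    by (rule sum.reindex_bij_witness[of _ "\<lambda>(s, x). \<lambda>i\<in>{1..n}. (s i, x i)"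
          "\<lambda>z. (\<lambda>i\<in>{1..n}. fst (z i), \<lambda>i\<in>{1..n}. snd (z i))"])
      (simp_all only: prod.case unzip,
        auto simp: state_seqs_def symbol_seqs_def PiE_def Pi_def extensional_def fun_eq_iff mem_Times_iff)
qed

text \<open>\<open>T\<close> collects the noise sequences of probability at least
  \<open>2^-Y\<close>, so it has at most \<open>2^Y\<close> elements. If a state leaves fewer than
  \<open>2^R / 2\<close> inputs leading into \<open>T\<close>, then its good inputs, each of
  conditional weight at most \<open>2^-R\<close>, have mass at most 1/2. The mass of such states is
  therefore at most twice that of the pairs that are not good.\<close>

lemma typical_noise_set:
  fixes q n :: nat and lam \<delta> C :: real and c :: "nat \<Rightarrow> nat \<Rightarrow> real"
  assumes q: "0 < q" and n: "0 < n" and lam: "0 \<le> lam" "lam \<le> 1" and \<delta>: "0 < \<delta>"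
    and c: "\<And>i. i \<in> {1..n} \<Longrightarrow> c i \<in> prob_simplex q"
    and var1: "\<And>i. i \<in> {1..n} \<Longrightarrow>
      letter_variance q lam (c i) (input_surprisal q (c i)) (rate_bound1 q lam (c i)) \<le> C"
    and var2: "\<And>i. i \<in> {1..n} \<Longrightarrow>
      letter_variance q lam (c i) (noise_surprisal lam (c i)) (shannon_entropy q (state_mix lam (c i))) \<le> C"
  shows "\<exists>T\<subseteq>symbol_seqs q n.
    card T \<le> 2 powr ((\<Sum>i\<in>{1..n}. shannon_entropy q (state_mix lam (c i))) + n * \<delta>) \<and>
    (\<Sum>s\<in>state_seqs n. state_weight lam n s * of_bool
      (card {x \<in> symbol_seqs q n. noise n s x \<in> T}
        < 2 powr ((\<Sum>i\<in>{1..n}. rate_bound1 q lam (c i)) - n * \<delta>) / 2)) \<le> 4 * C / (n * \<delta>\<^sup>2)"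
proof -
  let ?X = "symbol_seqs q n" and ?S = "state_seqs n" and ?w = "state_weight lam n"
  let ?m = "\<lambda>i. state_mix lam (c i)"
  define R where "R = (\<Sum>i\<in>{1..n}. rate_bound1 q lam (c i)) - n * \<delta>"
  define Y where "Y = (\<Sum>i\<in>{1..n}. shannon_entropy q (?m i)) + n * \<delta>"
  define k where "k s x = (\<Prod>i\<in>{1..n}. input_kernel q (c i) (s i) (x i))" for s x
  define pv where "pv v = (\<Prod>i\<in>{1..n}. ?m i (v i))" for v
  define T where "T = {v \<in> ?X. 2 powr - Y \<le> pv v}"
  define good where "good s x \<longleftrightarrow> k s x \<le> 2 powr - R \<and> noise n s x \<in> T" for s x
  define dev1 where "dev1 s x = (\<Sum>i\<in>{1..n}. input_surprisal q (c i) (s i, x i) - rate_bound1 q lam (c i))" for s x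
  define dev2 where "dev2 s x = (\<Sum>i\<in>{1..n}. noise_surprisal lam (c i) (s i, x i) - shannon_entropy q (?m i))" for s x
  have c_nonneg: "0 \<le> c i y" if "i \<in> {1..n}" "y < q" for i y
    using c[OF that(1)] that(2) by (simp add: prob_simplex_def)
  have kern_nonneg: "0 \<le> input_kernel q (c i) b y" if "i \<in> {1..n}" "y < q" for i b y
    using c_nonneg[OF that] by (simp add: input_kernel_def)
  have k_nonneg: "0 \<le> k s x" if "x \<in> ?X" for s x
    unfolding k_def using that by (intro prod_nonneg kern_nonneg) (auto simp: symbol_seqs_def)
  have k_sum: "(\<Sum>x\<in>?X. k s x) = 1" for s
  proof -
    have "(\<Sum>x\<in>?X. k s x) = (\<Prod>i\<in>{1..n}. \<Sum>y<q. input_kernel q (c i) (s i) y)"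
      unfolding k_def symbol_seqs_def by (subst prod_sum_PiE) auto
    also have "\<dots> = 1"
    proof (intro prod.neutral ballI)
      fix i assume "i \<in> {1..n}"
      from c[OF this] q show "(\<Sum>y<q. input_kernel q (c i) (s i) y) = 1"
        by (cases "s i") (simp_all add: input_kernel_def prob_simplex_def)
    qed
    finally show ?thesis .
  qed
  have joint: "(\<Prod>i\<in>{1..n}. letter_joint q lam (c i) (s i, x i)) = ?w s * k s x" for s x
    by (simp add: letter_joint_def state_weight_def k_def prod.distrib)
  have pos: "0 < input_kernel q (c i) (s i) (x i)" "0 < ?m i (noise n s x i)"
    if x: "x \<in> ?X" and p: "0 < ?w s * k s x" and i: "i \<in> {1..n}" for s x i
  proof -
    have xq: "x i < q" using x i by (auto simp: symbol_seqs_def)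
    have "?w s \<noteq> 0" "k s x \<noteq> 0" using p by auto
    then have "(if s i then lam else 1 - lam) \<noteq> 0" "input_kernel q (c i) (s i) (x i) \<noteq> 0"
      using i unfolding state_weight_def k_def by (auto simp: prod_zero_iff split: if_splits)
    moreover from this show kp: "0 < input_kernel q (c i) (s i) (x i)"
      using kern_nonneg[OF i xq, of "s i"] by simp
    ultimately show "0 < ?m i (noise n s x i)"
      using i lam q c_nonneg[OF i, of 0]
      by (cases "s i")
        (simp_all add: state_mix_def noise_def delta0_def input_kernel_def add_pos_nonneg add_nonneg_pos)
  qed
  have cheb1: "(\<Sum>s\<in>?S. \<Sum>x\<in>?X. ?w s * k s x * of_bool (n * \<delta> < \<bar>dev1 s x\<bar>)) \<le> n * C / (n * \<delta>)\<^sup>2"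
  proof -
    let ?f = "\<lambda>i a. input_surprisal q (c i) a - rate_bound1 q lam (c i)"
    have "(\<Sum>z\<in>{1..n} \<rightarrow>\<^sub>E UNIV \<times> {..<q}. (\<Prod>i\<in>{1..n}. letter_joint q lam (c i) (z i))
        * of_bool (n * \<delta> < \<bar>\<Sum>i\<in>{1..n}. ?f i (z i)\<bar>)) \<le> card {1..n} * C / (n * \<delta>)\<^sup>2"
    proof (rule product_chebyshev[where w = "\<lambda>i. letter_joint q lam (c i)" and f = ?f])
      fix i assume i: "i \<in> {1..n}"
      show "(\<Sum>a\<in>UNIV \<times> {..<q}. letter_joint q lam (c i) a) = 1"
        using c[OF i] q by (rule sum_letter_joint_1)
      show "(\<Sum>a\<in>UNIV \<times> {..<q}. letter_joint q lam (c i) a * ?f i a) = 0"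
        by (rule centered_mean[OF c[OF i] q mean_input_surprisal[OF q]])
      show "(\<Sum>a\<in>UNIV \<times> {..<q}. letter_joint q lam (c i) a * (?f i a)\<^sup>2) \<le> C"
        using var1[OF i] by (simp add: letter_variance_def)
      show "0 \<le> letter_joint q lam (c i) a" if "a \<in> UNIV \<times> {..<q}" for a
        by (rule letter_joint_nonneg[OF c[OF i] lam that])
    qed (use n \<delta> in auto)
    then show ?thesis unfolding sum_pair_seqs by (simp add: joint[simplified] dev1_def)
  qed
  have cheb2: "(\<Sum>s\<in>?S. \<Sum>x\<in>?X. ?w s * k s x * of_bool (n * \<delta> < \<bar>dev2 s x\<bar>)) \<le> n * C / (n * \<delta>)\<^sup>2"
  proof -
    let ?f = "\<lambda>i a. noise_surprisal lam (c i) a - shannon_entropy q (?m i)"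
    have "(\<Sum>z\<in>{1..n} \<rightarrow>\<^sub>E UNIV \<times> {..<q}. (\<Prod>i\<in>{1..n}. letter_joint q lam (c i) (z i))
        * of_bool (n * \<delta> < \<bar>\<Sum>i\<in>{1..n}. ?f i (z i)\<bar>)) \<le> card {1..n} * C / (n * \<delta>)\<^sup>2"
    proof (rule product_chebyshev[where w = "\<lambda>i. letter_joint q lam (c i)" and f = ?f])
      fix i assume i: "i \<in> {1..n}"
      show "(\<Sum>a\<in>UNIV \<times> {..<q}. letter_joint q lam (c i) a) = 1"
        using c[OF i] q by (rule sum_letter_joint_1)
      show "(\<Sum>a\<in>UNIV \<times> {..<q}. letter_joint q lam (c i) a * ?f i a) = 0"
        by (rule centered_mean[OF c[OF i] q mean_noise_surprisal[OF q]])
      show "(\<Sum>a\<in>UNIV \<times> {..<q}. letter_joint q lam (c i) a * (?f i a)\<^sup>2) \<le> C"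
        using var2[OF i] by (simp add: letter_variance_def)
      show "0 \<le> letter_joint q lam (c i) a" if "a \<in> UNIV \<times> {..<q}" for a
        by (rule letter_joint_nonneg[OF c[OF i] lam that])
    qed (use n \<delta> in auto)
    then show ?thesis unfolding sum_pair_seqs by (simp add: joint[simplified] dev2_def)
  qed
  have not_good: "?w s * k s x * of_bool (\<not> good s x)
      \<le> ?w s * k s x * of_bool (n * \<delta> < \<bar>dev1 s x\<bar>) + ?w s * k s x * of_bool (n * \<delta> < \<bar>dev2 s x\<bar>)"
    if x: "x \<in> ?X" for s x
  proof (cases "0 < ?w s * k s x")
    case True
    note ps = pos[OF x True]
    have "0 < k s x" unfolding k_def by (intro prod_pos ps)
    have "0 < pv (noise n s x)" unfolding pv_def by (intro prod_pos ps)
    have d1: "dev1 s x = - log 2 (k s x) - (R + n * \<delta>)"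
      using log_prod[of "{1..n}", OF _ ps(1)]
      by (simp add: dev1_def R_def k_def input_surprisal_def sum_subtractf sum_negf)
    have "noise_surprisal lam (c i) (s i, x i) = - log 2 (?m i (noise n s x i))" if "i \<in> {1..n}" for i
      using that by (simp add: noise_surprisal_def noise_def)
    then have d2: "dev2 s x = - log 2 (pv (noise n s x)) - (Y - n * \<delta>)"
      using log_prod[of "{1..n}", OF _ ps(2)]
      by (simp add: dev2_def Y_def pv_def sum_subtractf sum_negf)
    have "n * \<delta> < \<bar>dev1 s x\<bar> \<or> n * \<delta> < \<bar>dev2 s x\<bar>" if "\<not> good s x"
    proof (cases "k s x \<le> 2 powr - R")
      case False
      then have "- R < log 2 (k s x)" using \<open>0 < k s x\<close> by (simp add: less_log_iff)
      then show ?thesis using d1 by linarith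
    next
      case True
      then have "pv (noise n s x) < 2 powr - Y"
        using that x noise_in[OF q x] by (auto simp: good_def T_def)
      then have "log 2 (pv (noise n s x)) < - Y" using \<open>0 < pv (noise n s x)\<close> by (simp add: log_less_iff)
      then show ?thesis using d2 by linarith
    qed
    then show ?thesis using True by (auto simp: less_imp_le)
  next
    case False
    moreover have "0 \<le> ?w s * k s x" using k_nonneg[OF x] state_weight_nonneg[OF lam] by simp
    ultimately have "?w s * k s x = 0" by linarith
    then show ?thesis by (simp only: mult_zero_left add_0_right order_refl)
  qed
  have bad: "of_bool (card {x \<in> ?X. noise n s x \<in> T} < 2 powr R / 2)
      \<le> 2 * (\<Sum>x\<in>?X. k s x * of_bool (\<not> good s x))" for s
  proof (cases "card {x \<in> ?X. noise n s x \<in> T} < 2 powr R / 2")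
    case True
    let ?A = "{x \<in> ?X. noise n s x \<in> T}"
    have "(\<Sum>x\<in>?X. k s x * of_bool (good s x)) \<le> (\<Sum>x\<in>?X. if x \<in> ?A then 2 powr - R else 0)"
      by (intro sum_mono) (auto simp: good_def)
    also have "\<dots> = card ?A * 2 powr - R"
      by (simp add: sum.If_cases finite_symbol_seqs Int_def)
    also have "\<dots> \<le> (2 powr R / 2) * 2 powr - R" using True by (intro mult_right_mono) auto
    also have "\<dots> = 1 / 2" by (simp add: powr_minus)
    finally have "(\<Sum>x\<in>?X. k s x * of_bool (good s x)) \<le> 1 / 2" .
    moreover have "(\<Sum>x\<in>?X. k s x * of_bool (good s x)) + (\<Sum>x\<in>?X. k s x * of_bool (\<not> good s x)) = 1"
      unfolding sum.distrib[symmetric] k_sum[of s, symmetric] by (intro sum.cong) auto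
    ultimately show ?thesis using True by simp
  next
    case False
    then show ?thesis using k_nonneg by (simp add: sum_nonneg)
  qed
  have "(\<Sum>s\<in>?S. ?w s * of_bool (card {x \<in> ?X. noise n s x \<in> T} < 2 powr R / 2))
      \<le> (\<Sum>s\<in>?S. ?w s * (2 * (\<Sum>x\<in>?X. k s x * of_bool (\<not> good s x))))"
    by (intro sum_mono mult_left_mono bad state_weight_nonneg lam)
  also have "\<dots> = 2 * (\<Sum>s\<in>?S. \<Sum>x\<in>?X. ?w s * k s x * of_bool (\<not> good s x))"
    by (simp add: sum_distrib_left mult_ac)
  also have "\<dots> \<le> 2 * (\<Sum>s\<in>?S. \<Sum>x\<in>?X. ?w s * k s x * of_bool (n * \<delta> < \<bar>dev1 s x\<bar>)
      + ?w s * k s x * of_bool (n * \<delta> < \<bar>dev2 s x\<bar>))"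
    by (intro mult_left_mono sum_mono not_good) auto
  \<comment> \<open>One factor 2 comes from the threshold 1/2, the other from the two deviation
    events.\<close>
  also have "\<dots> \<le> 2 * (2 * (n * C / (n * \<delta>)\<^sup>2))"
    unfolding sum.distrib mult_2[of "n * C / (n * \<delta>)\<^sup>2"]
    by (intro mult_left_mono add_mono cheb1 cheb2) simp
  also have "\<dots> = 4 * C / (n * \<delta>\<^sup>2)" using n \<delta> by (simp add: power2_eq_square field_simps)
  finally have 1: "(\<Sum>s\<in>?S. ?w s * of_bool (card {x \<in> ?X. noise n s x \<in> T} < 2 powr R / 2))
      \<le> 4 * C / (n * \<delta>\<^sup>2)" .
  have m_simplex: "?m i \<in> prob_simplex q" if "i \<in> {1..n}" for i
    using c[OF that] lam q by (intro state_mix_simplex)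
  have "card T * 2 powr - Y = (\<Sum>v\<in>T. 2 powr - Y)" by simp
  also have "\<dots> \<le> (\<Sum>v\<in>T. pv v)" by (intro sum_mono) (simp add: T_def)
  also have "\<dots> \<le> (\<Sum>v\<in>?X. pv v)"
  proof (rule sum_mono2[OF finite_symbol_seqs])
    fix v assume v: "v \<in> ?X - T"
    have "0 \<le> ?m i (v i)" if i: "i \<in> {1..n}" for i
    proof -
      have "v i < q" using v i by (auto simp: symbol_seqs_def)
      then show ?thesis using m_simplex[OF i] by (simp add: prob_simplex_def)
    qed
    then show "0 \<le> pv v" unfolding pv_def by (rule prod_nonneg)
  qed (auto simp: T_def)
  also have "\<dots> = (\<Prod>i\<in>{1..n}. \<Sum>y<q. ?m i y)"
    unfolding pv_def symbol_seqs_def by (subst prod_sum_PiE) auto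
  also have "\<dots> = 1" using m_simplex by (intro prod.neutral) (auto simp: prob_simplex_def)
  finally have "card T \<le> 2 powr Y" by (simp add: powr_minus field_simps)
  moreover have "T \<subseteq> ?X" by (auto simp: T_def)
  ultimately show ?thesis using 1 unfolding R_def Y_def by blast
qed

lemma is_code_mono:
  "is_code q lam n R1 R2 \<epsilon> f1 f2 g1 g2 \<Longrightarrow> \<epsilon> \<le> \<epsilon>' \<Longrightarrow> is_code q lam n R1 R2 \<epsilon>' f1 f2 g1 g2"
  by (auto simp: is_code_def)

text \<open>The error terms stand for states with too few candidates, for messages without a
  candidate of their colour, and for outputs that fall into the region of an earlier
  codeword.\<close>

lemma code_exists:
  fixes q n :: nat and lam R1 R2 K \<eta> :: real
  assumes q: "0 < q" and lam: "0 \<le> lam" "lam \<le> 1" and R: "0 \<le> R1" "0 \<le> R2"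
    and T: "T \<subseteq> symbol_seqs q n" and K: "0 < K"
    and bad: "(\<Sum>s\<in>state_seqs n. state_weight lam n s * of_bool
      (card {x \<in> symbol_seqs q n. noise n s x \<in> T} < K)) \<le> \<eta>"
  shows "\<exists>f1 f2 g1 g2. is_code q lam n R1 R2
    (\<eta> + card (messages n R1) / K + card (messages n R2) * card T / real q ^ n) f1 f2 g1 g2"
proof -
  let ?X = "symbol_seqs q n" and ?S = "state_seqs n" and ?w = "state_weight lam n"
  let ?M1 = "messages n R1" and ?M2 = "messages n R2"
  let ?L1 = "card ?M1" and ?L2 = "card ?M2"
  define A where "A s = {x \<in> ?X. noise n s x \<in> T}" for s
  have L: "0 < ?L1" "0 < ?L2" using card_messages_pos R by auto
  have ne: "?M1 \<noteq> {}" "?M2 \<noteq> {}" using one_in_messages[OF R(1)] one_in_messages[OF R(2)] by auto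
  have AX: "A s \<inter> ?X = A s" for s by (auto simp: A_def)
  obtain g where g: "g \<in> ?X \<rightarrow> ?M1" "(\<Sum>s\<in>?S. \<Sum>m\<in>?M1. ?w s / ?L1 * of_bool (\<forall>x\<in>A s. g x \<noteq> m))
    \<le> (\<Sum>s\<in>?S. \<Sum>m\<in>?M1. ?w s / ?L1 * (1 - 1 / ?L1) ^ card (A s))"
  proof -
    have "\<exists>g\<in>?X \<rightarrow> ?M1.
      (\<Sum>s\<in>?S. \<Sum>m\<in>?M1. ?w s / ?L1 * of_bool (\<forall>x\<in>A s \<inter> ?X. g x \<noteq> m))
      \<le> (\<Sum>s\<in>?S. \<Sum>m\<in>?M1. ?w s / ?L1 * (1 - 1 / ?L1) ^ card (A s \<inter> ?X))"
      by (rule exists_binning)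
        (use state_weight_nonneg[OF lam] ne(1) in \<open>auto simp: finite_symbol_seqs finite_state_seqs finite_messages\<close>)
    then show ?thesis using that unfolding AX by blast
  qed
  have "(\<Sum>s\<in>?S. \<Sum>m\<in>?M1. ?w s / ?L1 * (1 - 1 / ?L1) ^ card (A s))
      = (\<Sum>s\<in>?S. ?w s * (1 - 1 / ?L1) ^ card (A s))"
    using L by simp
  also have "\<dots> \<le> (\<Sum>s\<in>?S. ?w s * (of_bool (card (A s) < K) + ?L1 / K))"
  proof (intro sum_mono mult_left_mono state_weight_nonneg lam)
    fix s
    have base: "0 \<le> 1 - 1 / real ?L1" "1 - 1 / real ?L1 \<le> 1" using L by (auto simp: divide_le_eq)
    show "(1 - 1 / ?L1) ^ card (A s) \<le> of_bool (card (A s) < K) + ?L1 / K"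
    proof (cases "card (A s) < K")
      case True
      have "(1 - 1 / ?L1) ^ card (A s) \<le> 1" by (rule power_le_one[OF base])
      then show ?thesis using True K by (simp add: add_increasing2)
    next
      case False
      have t: "0 < card (A s) / ?L1" using False K L by simp
      \<comment> \<open>With \<open>a = card (A s)\<close> the chain is
        \<open>(1 - 1/L)^a \<le> exp (- a/L) \<le> L/a\<close>; the crude last bound suffices
        because \<open>L / K\<close> will tend to 0.\<close>
      have "(1 - 1 / ?L1) ^ card (A s) \<le> exp (- (1 / ?L1)) ^ card (A s)"
        using base exp_ge_add_one_self[of "- (1 / real ?L1)"] by (intro power_mono) auto
      also have "\<dots> = exp (card (A s) * - (1 / ?L1))" by (rule exp_of_nat_mult[symmetric])
      also have "\<dots> = 1 / exp (card (A s) / ?L1)" by (simp add: exp_minus inverse_eq_divide)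
      also have "\<dots> \<le> 1 / (card (A s) / ?L1)"
        using exp_ge_add_one_self[of "card (A s) / ?L1"]
        by (intro divide_left_mono mult_pos_pos exp_gt_zero t; linarith)
      also have "\<dots> = ?L1 / card (A s)" by simp
      also have "\<dots> \<le> ?L1 / K" using False K by (intro divide_left_mono) auto
      finally show ?thesis using False by simp
    qed
  qed
  also have "\<dots> = (\<Sum>s\<in>?S. ?w s * of_bool (card (A s) < K)) + ?L1 / K"
    by (simp add: distrib_left sum.distrib sum_divide_distrib[symmetric] sum_distrib_right[symmetric]
        sum_state_weight)
  also have "\<dots> \<le> \<eta> + ?L1 / K" using bad by (simp add: A_def)
  finally have fail: "(\<Sum>s\<in>?S. \<Sum>m\<in>?M1. ?w s / ?L1 * of_bool (\<forall>x\<in>A s. g x \<noteq> m)) \<le> \<eta> + ?L1 / K"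
    using g(2) by linarith
  \<comment> \<open>The all-zero default keeps the input in the alphabet; its use is charged as an
    error to both receivers.\<close>
  define enc where "enc m s = (if \<exists>x\<in>A s. g x = m then SOME x. x \<in> A s \<and> g x = m
    else (\<lambda>i\<in>{1..n}. 0))" for m s
  have enc_ok: "enc m s \<in> A s \<and> g (enc m s) = m" if "\<not> (\<forall>x\<in>A s. g x \<noteq> m)" for m s
    using that someI_ex[of "\<lambda>x. x \<in> A s \<and> g x = m"] by (auto simp: enc_def)
  have enc_in: "enc m s \<in> ?X" for m s
  proof (cases "\<forall>x\<in>A s. g x \<noteq> m")
    case True
    then have "enc m s = (\<lambda>i\<in>{1..n}. 0)" by (simp add: enc_def)
    then show ?thesis using q by (simp add: symbol_seqs_def)
  next
    case False
    then show ?thesis using enc_ok[of s m] by (simp add: A_def)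
  qed
  define f1 where "f1 i m s = enc m s i" for i m s
  have rec1: "received1 n f1 m s = enc m s" for m s
    using enc_in[of m s] by (auto simp: received1_def f1_def channel_out1_def symbol_seqs_def
        PiE_def extensional_def fun_eq_iff)
  define P where "P = (\<lambda>(m::nat, s). ?w s / ?L1)"
  define V where "V = (\<lambda>(m, s). noise n s (enc m s))"
  have sumP: "(\<Sum>z\<in>?M1 \<times> ?S. P z * F z) = (\<Sum>m\<in>?M1. \<Sum>s\<in>?S. ?w s / ?L1 * F (m, s))" for F
    by (simp add: P_def sum.cartesian_product case_prod_unfold)
  have P1: "sum P (?M1 \<times> ?S) = 1"
    using sumP[of "\<lambda>_. 1"] L by (simp add: sum_divide_distrib[symmetric] sum_state_weight)
  have finT: "finite T" using T finite_symbol_seqs by (rule finite_subset)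
  have P_nonneg: "0 \<le> P z" for z using state_weight_nonneg[OF lam] by (simp add: P_def case_prod_unfold)
  \<comment> \<open>Codebook indices start at 0 and messages at 1, so index \<open>?L2\<close> has
    to be included.\<close>
  obtain c where c: "\<And>j. j < Suc ?L2 \<Longrightarrow> c j \<in> ?X \<and>
      (\<Sum>z\<in>?M1 \<times> ?S. P z * of_bool (seq_add q n (c j) (V z) \<in> (\<Union>i<j. seq_add q n (c i) ` T)))
      \<le> j * card T / real q ^ n"
    using exists_codebook[OF q _ P_nonneg P1 finT, where k = "Suc ?L2" and V = V and n = n]
    by (auto simp: finite_messages finite_state_seqs)
  have M2_le: "m \<le> ?L2" if "m \<in> ?M2" for m using that by (simp add: messages_eq)
  define f2 where "f2 i m = c m i" for i m
  let ?hit = "\<lambda>y m. m \<in> ?M2 \<and> y \<in> seq_add q n (c m) ` T"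
  \<comment> \<open>The default 1 is a valid message.\<close>
  define g2 where "g2 y = (if \<exists>m. ?hit y m then LEAST m. ?hit y m else 1)" for y
  have g2_in: "g2 y \<in> ?M2" for y
    using LeastI_ex[of "?hit y"] one_in_messages[OF R(2)] by (auto simp: g2_def)
  have rec2: "received2 q n f1 f2 m1 m2 s = seq_add q n (c m2) (V (m1, s))" for m1 m2 s
    by (simp add: received2_eq f1_def f2_def V_def)
  \<comment> \<open>If encoder 1 succeeds, the noise lies in \<open>T\<close> and the true message
    is a hit, so a wrong decision means a smaller hit.\<close>
  have g2_err: "of_bool (g2 (seq_add q n (c m2) (V (m1, s))) \<noteq> m2)
      \<le> of_bool (\<forall>x\<in>A s. g x \<noteq> m1) +
        (of_bool (seq_add q n (c m2) (V (m1, s)) \<in> (\<Union>i<m2. seq_add q n (c i) ` T)) :: real)"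
    if m2: "m2 \<in> ?M2" for m1 m2 s
  proof (cases "(\<forall>x\<in>A s. g x \<noteq> m1) \<or> g2 (seq_add q n (c m2) (V (m1, s))) = m2")
    case False
    let ?y = "seq_add q n (c m2) (V (m1, s))"
    have "V (m1, s) \<in> T" using enc_ok[of s m1] False by (auto simp: V_def A_def)
    with m2 have hit: "?hit ?y m2" by blast
    then have g2: "g2 ?y = (LEAST m. ?hit ?y m)" unfolding g2_def by meson
    have "g2 ?y \<le> m2" unfolding g2 by (rule Least_le) (rule hit)
    moreover have "?hit ?y (g2 ?y)" unfolding g2 by (rule LeastI) (rule hit)
    ultimately have "?y \<in> (\<Union>i<m2. seq_add q n (c i) ` T)" using False by auto
    then show ?thesis by simp
  qed auto
  let ?\<epsilon> = "\<eta> + ?L1 / K + ?L2 * card T / real q ^ n"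
  have fail': "(\<Sum>m\<in>?M1. \<Sum>s\<in>?S. ?w s / ?L1 * of_bool (\<forall>x\<in>A s. g x \<noteq> m)) \<le> \<eta> + ?L1 / K"
    using fail by (subst sum.swap)
  have err1: "measure_pmf.prob (source_pmf lam n R1 R2)
      {(m1, m2, s). g (received1 n f1 m1 s) \<noteq> m1} \<le> ?\<epsilon>"
  proof -
    have "measure_pmf.prob (source_pmf lam n R1 R2) {(m1, m2, s). g (received1 n f1 m1 s) \<noteq> m1}
        = (\<Sum>m\<in>?M1. \<Sum>s\<in>?S. ?w s / ?L1 * of_bool (g (enc m s) \<noteq> m))"
      unfolding rec1 source_prob_eq[OF R lam, of n "\<lambda>m1 m2 s. g (enc m1 s) \<noteq> m1"]
      using L by (simp add: sum_distrib_left)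
    also have "\<dots> \<le> (\<Sum>m\<in>?M1. \<Sum>s\<in>?S. ?w s / ?L1 * of_bool (\<forall>x\<in>A s. g x \<noteq> m))"
      using enc_ok state_weight_nonneg[OF lam] by (intro sum_mono mult_left_mono) auto
    also have "\<dots> \<le> \<eta> + ?L1 / K" by (rule fail')
    also have "\<dots> \<le> ?\<epsilon>" by simp
    finally show ?thesis .
  qed
  have err2: "measure_pmf.prob (source_pmf lam n R1 R2)
      {(m1, m2, s). g2 (received2 q n f1 f2 m1 m2 s) \<noteq> m2} \<le> ?\<epsilon>"
  proof -
    let ?col = "\<lambda>m2 z. of_bool (seq_add q n (c m2) (V z) \<in> (\<Union>i<m2. seq_add q n (c i) ` T)) :: real"
    have "measure_pmf.prob (source_pmf lam n R1 R2) {(m1, m2, s). g2 (received2 q n f1 f2 m1 m2 s) \<noteq> m2}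
        = (\<Sum>m2\<in>?M2. (\<Sum>m1\<in>?M1. \<Sum>s\<in>?S. ?w s / ?L1 *
            of_bool (g2 (seq_add q n (c m2) (V (m1, s))) \<noteq> m2)) / ?L2)"
      unfolding rec2
        source_prob_eq[OF R lam, of n "\<lambda>m1 m2 s. g2 (seq_add q n (c m2) (V (m1, s))) \<noteq> m2"]
      by (subst sum.swap) (simp add: sum_divide_distrib)
    also have "\<dots> \<le> (\<Sum>m2\<in>?M2. (\<Sum>m1\<in>?M1. \<Sum>s\<in>?S. ?w s / ?L1 *
            (of_bool (\<forall>x\<in>A s. g x \<noteq> m1) + ?col m2 (m1, s))) / ?L2)"
      using state_weight_nonneg[OF lam]
      by (intro sum_mono divide_right_mono mult_left_mono g2_err) auto
    also have "\<dots> = (\<Sum>m2\<in>?M2. ((\<Sum>m1\<in>?M1. \<Sum>s\<in>?S. ?w s / ?L1 * of_bool (\<forall>x\<in>A s. g x \<noteq> m1))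
        + (\<Sum>z\<in>?M1 \<times> ?S. P z * ?col m2 z)) / ?L2)"
      by (simp only: sumP distrib_left sum.distrib)
    also have "\<dots> \<le> (\<Sum>m2\<in>?M2. ((\<eta> + ?L1 / K) + ?L2 * card T / real q ^ n) / ?L2)"
    proof (intro sum_mono divide_right_mono add_mono fail')
      fix m2 assume m2: "m2 \<in> ?M2"
      have "(\<Sum>z\<in>?M1 \<times> ?S. P z * ?col m2 z) \<le> m2 * card T / real q ^ n"
        using c[of m2] M2_le[OF m2] by simp
      also have "\<dots> \<le> ?L2 * card T / real q ^ n"
        using M2_le[OF m2] by (intro divide_right_mono) (auto simp only: of_nat_le_iff mult_le_mono1, simp)
      finally show "(\<Sum>z\<in>?M1 \<times> ?S. P z * ?col m2 z) \<le> ?L2 * card T / real q ^ n" .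
    qed auto
    also have "\<dots> = ?\<epsilon>" using L by simp
    finally show ?thesis .
  qed
  have "is_code q lam n R1 R2 ?\<epsilon> f1 f2 g g2"
    unfolding is_code_def
  proof (intro conjI ballI)
    fix i m s assume "i \<in> {1..n}"
    then show "f1 i m s < q" using enc_in[of m s] by (auto simp: f1_def symbol_seqs_def)
  next
    fix i m assume "i \<in> {1..n}" "m \<in> ?M2"
    then show "f2 i m < q" using c[of m] M2_le[of m] by (auto simp: f2_def symbol_seqs_def)
  qed (use g(1) g2_in err1 err2 in auto)
  then show ?thesis by blast
qed

lemma achievable_below_hull:
  fixes q :: nat and lam R1 R2 :: real
  assumes q: "0 < q" and lam: "0 \<le> lam" "lam \<le> 1"
    and hull: "(U, W) \<in> convex hull rate_pairs q lam"
    and R: "0 \<le> R1" "R1 < U" "0 \<le> R2" "R2 < W"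
  shows "achievable q lam (R1, R2)"
proof -
  let ?f = "\<lambda>p. (rate_bound1 q lam p, rate_bound2 q lam p)"
  obtain F K where F: "finite F" "F \<subseteq> prob_simplex q" and
    sched: "\<And>n. \<exists>c. (\<forall>i\<in>{1..n}. c i \<in> F) \<and> norm ((\<Sum>i\<in>{1..n}. ?f (c i)) - real n *\<^sub>R (U, W)) \<le> K"
    using convex_hull_schedule[OF hull[unfolded rate_pairs_def]] by blast
  let ?v1 = "\<lambda>p. letter_variance q lam p (input_surprisal q p) (rate_bound1 q lam p)"
  let ?v2 = "\<lambda>p. letter_variance q lam p (noise_surprisal lam p) (shannon_entropy q (state_mix lam p))"
  define C where "C = (\<Sum>p\<in>F. \<bar>?v1 p\<bar> + \<bar>?v2 p\<bar>)"
  have C: "?v1 p \<le> C" "?v2 p \<le> C" if "p \<in> F" for p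
  proof -
    have "\<bar>?v1 p\<bar> + \<bar>?v2 p\<bar> \<le> C" unfolding C_def using F that by (intro member_le_sum) auto
    then show "?v1 p \<le> C" "?v2 p \<le> C" by linarith+
  qed
  \<comment> \<open>Half of the slack: one \<open>\<delta>\<close> per channel use is spent on
    typicality, the other drives the errors to 0.\<close>
  define \<delta> where "\<delta> = min (U - R1) (W - R2) / 2"
  have \<delta>: "0 < \<delta>" "R1 + 2 * \<delta> \<le> U" "R2 + 2 * \<delta> \<le> W" using R by (auto simp: \<delta>_def)
  \<comment> \<open>The terms are the Chebyshev bound, the binning failure, whose factor 2 stems
    from the halved count in \<open>typical_noise_set\<close>, and the codeword collisions.
    \<open>K\<close> absorbs the deviation of the schedule.\<close>
  define err where "err n = 4 * C / (n * \<delta>\<^sup>2) + 2 * 2 powr (K - n * \<delta>) + 2 powr (K - n * \<delta>)" for n :: nat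
  have code: "\<exists>f1 f2 g1 g2. is_code q lam n R1 R2 (err n) f1 f2 g1 g2" if n: "0 < n" for n
  proof -
    obtain c where cF: "\<forall>i\<in>{1..n}. c i \<in> F"
      and c: "norm ((\<Sum>i\<in>{1..n}. ?f (c i)) - real n *\<^sub>R (U, W)) \<le> K" using sched by blast
    let ?r1 = "\<Sum>i\<in>{1..n}. rate_bound1 q lam (c i)"
    let ?h = "\<Sum>i\<in>{1..n}. shannon_entropy q (state_mix lam (c i))"
    have "\<bar>fst ((\<Sum>i\<in>{1..n}. ?f (c i)) - real n *\<^sub>R (U, W))\<bar> \<le> K"
      "\<bar>snd ((\<Sum>i\<in>{1..n}. ?f (c i)) - real n *\<^sub>R (U, W))\<bar> \<le> K"
      using c norm_fst_le[of "fst ((\<Sum>i\<in>{1..n}. ?f (c i)) - real n *\<^sub>R (U, W))"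
          "snd ((\<Sum>i\<in>{1..n}. ?f (c i)) - real n *\<^sub>R (U, W))"]
        norm_snd_le[of "snd ((\<Sum>i\<in>{1..n}. ?f (c i)) - real n *\<^sub>R (U, W))"
          "fst ((\<Sum>i\<in>{1..n}. ?f (c i)) - real n *\<^sub>R (U, W))"]
      by (simp_all only: prod.collapse real_norm_def)
    then have r: "n * U - K \<le> ?r1" "?h \<le> n * log 2 q - n * W + K"
      by (simp_all add: fst_sum snd_sum rate_bound2_def sum_subtractf abs_le_iff)
    obtain T where T: "T \<subseteq> symbol_seqs q n" "card T \<le> 2 powr (?h + n * \<delta>)"
      "(\<Sum>s\<in>state_seqs n. state_weight lam n s * of_bool
        (card {x \<in> symbol_seqs q n. noise n s x \<in> T} < 2 powr (?r1 - n * \<delta>) / 2)) \<le> 4 * C / (n * \<delta>\<^sup>2)"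
      using typical_noise_set[OF q n lam \<delta>(1), of c C] cF F(2) C by blast
    obtain f1 f2 g1 g2 where code: "is_code q lam n R1 R2 (4 * C / (n * \<delta>\<^sup>2)
        + card (messages n R1) / (2 powr (?r1 - n * \<delta>) / 2)
        + card (messages n R2) * card T / real q ^ n) f1 f2 g1 g2"
      using code_exists[OF q lam R(1,3) T(1) _ T(3)] by auto
    have nd: "n * R1 + 2 * (n * \<delta>) \<le> n * U" "n * R2 + 2 * (n * \<delta>) \<le> n * W"
      using \<delta>(2,3) mult_left_mono[of _ _ "real n"] by (force simp: algebra_simps)+
    have "n * R1 - (?r1 - n * \<delta>) \<le> K - n * \<delta>" using r(1) nd(1) by linarith
    then have x1: "2 * 2 powr (n * R1 - (?r1 - n * \<delta>)) \<le> 2 * 2 powr (K - n * \<delta>)" by simp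
    have "card (messages n R1) / (2 powr (?r1 - n * \<delta>) / 2) \<le> 2 powr (n * R1) / (2 powr (?r1 - n * \<delta>) / 2)"
      using card_messages_le by (intro divide_right_mono) auto
    also have "\<dots> = 2 * 2 powr (n * R1 - (?r1 - n * \<delta>))" by (simp add: powr_diff)
    also note x1
    finally have e1: "card (messages n R1) / (2 powr (?r1 - n * \<delta>) / 2) \<le> 2 * 2 powr (K - n * \<delta>)" .
    have qn: "real q ^ n = 2 powr (n * log 2 q)"
      using q by (simp add: powr_powr[symmetric] mult.commute[of "real n"] powr_realpow)
    have "n * R2 + (?h + n * \<delta>) - n * log 2 q \<le> K - n * \<delta>" using r(2) nd(2) by linarith
    then have x2: "2 powr (n * R2 + (?h + n * \<delta>) - n * log 2 q) \<le> 2 powr (K - n * \<delta>)" by simp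
    have "card (messages n R2) * card T / real q ^ n
        \<le> 2 powr (n * R2) * 2 powr (?h + n * \<delta>) / real q ^ n"
      using card_messages_le T(2) by (simp add: mult_mono divide_right_mono)
    also have "\<dots> = 2 powr (n * R2 + (?h + n * \<delta>) - n * log 2 q)" by (simp add: qn powr_diff powr_add)
    also note x2
    finally have e2: "card (messages n R2) * card T / real q ^ n \<le> 2 powr (K - n * \<delta>)" .
    have "is_code q lam n R1 R2 (err n) f1 f2 g1 g2"
      by (rule is_code_mono[OF code]) (use e1 e2 in \<open>simp add: err_def\<close>)
    then show ?thesis by blast
  qed
  have "err \<longlonglongrightarrow> 0"
    unfolding err_def using \<delta>(1) by real_asymp
  show ?thesis
    unfolding achievable_def
  proof (simp only: prod.case, intro conjI allI impI R)
    fix \<epsilon> :: real assume "0 < \<epsilon>"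
    with \<open>err \<longlonglongrightarrow> 0\<close> have "eventually (\<lambda>n. err n < \<epsilon>) sequentially" by (rule order_tendstoD)
    then obtain N where N: "\<And>n. N \<le> n \<Longrightarrow> err n < \<epsilon>" by (auto simp: eventually_sequentially)
    show "\<exists>N. \<forall>n\<ge>N. \<exists>f1 f2 g1 g2. is_code q lam n R1 R2 \<epsilon> f1 f2 g1 g2"
    proof (intro exI[of _ "Suc N"] allI impI)
      fix n assume "Suc N \<le> n"
      then have "err n \<le> \<epsilon>" "0 < n" using N[of n] by auto
      then show "\<exists>f1 f2 g1 g2. is_code q lam n R1 R2 \<epsilon> f1 f2 g1 g2"
        using code[of n] is_code_mono by blast
    qed
  qed
qed

section \<open>The convex closure of the rate pairs\<close>

definition inner_rates :: "nat \<Rightarrow> real \<Rightarrow> (real \<times> real) set" where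
  "inner_rates q lam = {(R1, R2). 0 \<le> R1 \<and> 0 \<le> R2 \<and>
    (\<exists>p\<in>prob_simplex q. R1 < rate_bound1 q lam p \<and> R2 < rate_bound2 q lam p)}"

text \<open>The nonnegative points strictly below some point of
  \<open>convex hull rate_pairs q lam\<close> form a convex set: strictness survives averaging
  because the two weights do not both vanish.\<close>

lemma hull_inner_rates_below:
  assumes "(a, b) \<in> convex hull inner_rates q lam"
  obtains U W where "(U, W) \<in> convex hull rate_pairs q lam" "0 \<le> a" "a < U" "0 \<le> b" "b < W"
proof -
  define C where "C = {z. 0 \<le> fst z \<and> 0 \<le> snd z \<and>
    (\<exists>y\<in>convex hull rate_pairs q lam. fst z < fst y \<and> snd z < snd y)}"
  have "inner_rates q lam \<subseteq> C"
  proof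
    fix z assume "z \<in> inner_rates q lam"
    then obtain p where p: "p \<in> prob_simplex q" "0 \<le> fst z" "0 \<le> snd z"
      "fst z < rate_bound1 q lam p" "snd z < rate_bound2 q lam p"
      by (auto simp: inner_rates_def)
    have "(rate_bound1 q lam p, rate_bound2 q lam p) \<in> convex hull rate_pairs q lam"
      using p(1) by (intro hull_inc) (auto simp: rate_pairs_def)
    with p show "z \<in> C" unfolding C_def by force
  qed
  moreover have "convex C"
  proof (rule convexI)
    fix y z :: "real \<times> real" and u v :: real
    assume yz: "y \<in> C" "z \<in> C" and uv: "0 \<le> u" "0 \<le> v" "u + v = 1"
    obtain y' z' where y': "y' \<in> convex hull rate_pairs q lam" "fst y < fst y'" "snd y < snd y'"
      and z': "z' \<in> convex hull rate_pairs q lam" "fst z < fst z'" "snd z < snd z'"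
      using yz by (auto simp: C_def)
    have less: "u * s + v * t < u * s' + v * t'" if "s < s'" "t < t'" for s t s' t' :: real
    proof (cases "u = 0")
      case True
      then show ?thesis using that uv by simp
    next
      case False
      then have "u * s < u * s'" "v * t \<le> v * t'" using that uv by (auto intro: mult_left_mono)
      then show ?thesis by linarith
    qed
    have "u *\<^sub>R y' + v *\<^sub>R z' \<in> convex hull rate_pairs q lam"
      using y'(1) z'(1) uv by (intro convexD[OF convex_convex_hull])
    then show "u *\<^sub>R y + v *\<^sub>R z \<in> C"
      using yz uv less[OF y'(2) z'(2)] less[OF y'(3) z'(3)]
      by (auto simp: C_def intro!: bexI[of _ "u *\<^sub>R y' + v *\<^sub>R z'"])
  qed
  ultimately have "convex hull inner_rates q lam \<subseteq> C" by (rule hull_minimal)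
  with assms show ?thesis using that by (force simp: C_def)
qed

section \<open>Boundary points of the closed region\<close>

abbreviation uniform_law :: "nat \<Rightarrow> nat \<Rightarrow> real" where
  "uniform_law q \<equiv> (\<lambda>_. 1 / real q)"

lemma uniform_law_simplex: "0 < q \<Longrightarrow> uniform_law q \<in> prob_simplex q"
  by (simp add: prob_simplex_def)

lemma entropy_uniform_law: "0 < q \<Longrightarrow> shannon_entropy q (uniform_law q) = log 2 q"
  by (simp add: shannon_entropy_def log_divide)

text \<open>Equality in \<open>ln r \<le> r - 1\<close> holds only at \<open>r = 1\<close>, so a
  letter whose mass differs from \<open>1 / q\<close> makes its summand \<open>?d\<close> strictly
  positive.\<close>

lemma entropy_less_log:
  assumes p: "p \<in> prob_simplex q" and x: "x < q" "p x \<noteq> 1 / q"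
  shows "shannon_entropy q p < log 2 q"
proof -
  have q: "0 < q" using x by simp
  let ?d = "\<lambda>y. p y * ln (q * p y) - (p y - 1 / q)"
  have t: "0 \<le> ?d y \<and> (p y \<noteq> 1 / q \<longrightarrow> 0 < ?d y)" if y: "y < q" for y
  proof (cases "p y = 0")
    case False
    then have py: "0 < p y" using p y by (simp add: prob_simplex_def order_less_le)
    let ?r = "1 / (q * p y)"
    have r: "0 < ?r" using py q by simp
    have d: "?d y = p y * ((?r - 1) - ln ?r)"
      using py q by (simp add: ln_div field_simps)
    have "0 \<le> (?r - 1) - ln ?r" using ln_le_minus_one[OF r] by simp
    moreover have "0 < (?r - 1) - ln ?r" if "p y \<noteq> 1 / q"
    proof -
      have "?r \<noteq> 1" using that py q by (auto simp: field_simps)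
      then show ?thesis using ln_le_minus_one[OF r] ln_eq_minus_one[OF r] by linarith
    qed
    ultimately show ?thesis unfolding d using py by simp
  qed (use q in simp)
  have "0 < (\<Sum>y<q. ?d y)" using t x by (intro sum_pos2[of _ x]) auto
  \<comment> \<open>The corrections \<open>p y - 1 / q\<close> sum to 0.\<close>
  also have "\<dots> = (\<Sum>y<q. p y * ln (q * p y))"
    using p q by (simp add: sum_subtractf prob_simplex_def)
  also have "\<dots> = (\<Sum>y<q. p y * ln q + p y * ln (p y))"
  proof (rule sum.cong[OF refl])
    fix y assume "y \<in> {..<q}"
    then have "0 \<le> p y" using p by (simp add: prob_simplex_def)
    then show "p y * ln (q * p y) = p y * ln q + p y * ln (p y)"
      using q by (cases "p y = 0") (simp_all add: ln_mult distrib_left)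
  qed
  also have "\<dots> = ln q + (\<Sum>y<q. p y * ln (p y))"
    using p by (simp add: sum.distrib sum_distrib_right[symmetric] prob_simplex_def)
  finally have "0 < (ln q + (\<Sum>y<q. p y * ln (p y))) / ln 2" by simp
  then show ?thesis
    by (simp add: shannon_entropy_def log_def add_divide_distrib sum_divide_distrib)
qed

text \<open>For \<open>q = 1\<close> both bounds are 0, so the strict inequalities describe the
  empty set, while \<open>(0, 0)\<close> is achievable.\<close>

context
  fixes q :: nat and lam :: real
  assumes q: "2 \<le> q" and lam: "0 \<le> lam" "lam \<le> 1"
begin

lemma q_pos: "0 < q" using q by simp

lemma log_q_pos: "0 < log 2 (real q)" using q by simp

text \<open>Shrinking by factors below 1 makes both inequalities strict; at a zero coordinate this
  takes the positivity of the bound.\<close>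

lemma region_box:
  assumes p: "p \<in> prob_simplex q" and pos: "0 < rate_bound1 q lam p" "0 < rate_bound2 q lam p"
    and a: "0 \<le> a" "a \<le> rate_bound1 q lam p" and b: "0 \<le> b" "b \<le> rate_bound2 q lam p"
  shows "(a, b) \<in> closure (convex hull inner_rates q lam)"
proof -
  let ?t = "\<lambda>k::nat. 1 - 1 / real (k + 2)"
  have lt: "?t k * c < r" if "0 \<le> c" "c \<le> r" "0 < r" for c r :: real and k
  proof (cases "c = 0")
    case False
    then have "?t k * c < 1 * c" using that by (intro mult_strict_right_mono) auto
    with that show ?thesis by simp
  qed (use that in simp)
  have "(?t k * a, ?t k * b) \<in> inner_rates q lam" for k
    unfolding inner_rates_def using p lt[OF a pos(1)] lt[OF b pos(2)] a b by auto
  then have "(?t k * a, ?t k * b) \<in> closure (convex hull inner_rates q lam)" for k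
    by (intro subsetD[OF closure_subset] hull_inc)
  moreover have "(\<lambda>k. (?t k * a, ?t k * b)) \<longlonglongrightarrow> (1 * a, 1 * b)"
    by (intro tendsto_Pair tendsto_mult tendsto_const) real_asymp+
  ultimately show ?thesis
    using closed_sequentially[OF closed_closure] by fastforce
qed

lemma entropy_smoothed_ge:
  assumes "0 \<le> s" "s \<le> 1"
  shows "s * log 2 q \<le> shannon_entropy q (state_mix s (uniform_law q))"
  using entropy_state_mix_ge[OF uniform_law_simplex[OF q_pos] assms q_pos]
  by (simp add: entropy_uniform_law[OF q_pos])

text \<open>Mixing in a share \<open>s\<close> of the uniform law keeps at least the share
  \<open>s\<close> of \<open>log q\<close> in the first bound, while the excess mass at 0 prevents
  the noise from being uniform and so keeps the second bound positive.\<close>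

lemma smoothed_rates_pos:
  assumes s: "0 < s" "s < 1"
  defines "p \<equiv> state_mix s (uniform_law q)"
  shows "p \<in> prob_simplex q" "s * log 2 q \<le> rate_bound1 q lam p" "0 < rate_bound2 q lam p"
proof -
  show p: "p \<in> prob_simplex q"
    unfolding p_def using s q_pos by (intro state_mix_simplex uniform_law_simplex) auto
  have "lam * (s * log 2 q) \<le> lam * shannon_entropy q p"
    unfolding p_def using s lam by (intro mult_left_mono entropy_smoothed_ge) auto
  moreover have "(1 - lam) * (s * log 2 q) \<le> (1 - lam) * log 2 q"
    using s lam log_q_pos by (intro mult_left_mono) auto
  ultimately show "s * log 2 q \<le> rate_bound1 q lam p"
    unfolding rate_bound1_def by (simp add: algebra_simps)
  have q1: "1 / real q < 1" using q by simp
  have "0 < (1 - s) * (1 - 1 / real q)" using s q1 by simp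
  also have "\<dots> = p 0 - 1 / real q"
    by (simp add: p_def state_mix_def delta0_def algebra_simps diff_divide_distrib)
  finally have p0: "1 / real q < p 0" by simp
  have "0 < lam * (p 0 - 1 / q) + (1 - lam) * (1 - 1 / q)"
  proof (cases "lam = 0")
    case False
    then have "0 < lam * (p 0 - 1 / q)" using p0 lam by simp
    moreover have "0 \<le> (1 - lam) * (1 - 1 / q)" using q1 lam by simp
    ultimately show ?thesis by linarith
  qed (use q1 in simp)
  also have "\<dots> = state_mix lam p 0 - 1 / q"
    by (simp add: state_mix_def delta0_def algebra_simps diff_divide_distrib)
  finally have "state_mix lam p 0 \<noteq> 1 / q" by simp
  then show "0 < rate_bound2 q lam p"
    unfolding rate_bound2_def
    using entropy_less_log[OF state_mix_simplex[OF p lam q_pos] q_pos] by simp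
qed

text \<open>Serves laws whose second bound is 0: as the uniform share tends to 1, the first bound is
  pushed up to \<open>log q\<close>.\<close>

lemma region_axis1:
  assumes a: "0 \<le> a" "a \<le> log 2 q"
  shows "(a, 0) \<in> closure (convex hull inner_rates q lam)"
proof -
  let ?t = "\<lambda>k::nat. 1 - 1 / real (k + 2)"
  have "(?t k * a, 0) \<in> closure (convex hull inner_rates q lam)" for k
  proof -
    have t: "0 < ?t k" "?t k < 1" by (simp_all add: field_simps)
    note w = smoothed_rates_pos[OF t]
    have "0 < ?t k * log 2 q" using t log_q_pos by (intro mult_pos_pos)
    with w(2) have r1: "0 < rate_bound1 q lam (state_mix (?t k) (uniform_law q))" by linarith
    have "?t k * a \<le> ?t k * log 2 q" by (rule mult_left_mono[OF a(2) less_imp_le[OF t(1)]])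
    also note w(2)
    finally show ?thesis
      using w(3) t(1) a(1) by (intro region_box[OF w(1) r1]) (auto intro: mult_nonneg_nonneg)
  qed
  moreover have "(\<lambda>k. (?t k * a, 0::real)) \<longlonglongrightarrow> (1 * a, 0)"
    by (intro tendsto_Pair tendsto_mult tendsto_const) real_asymp
  ultimately show ?thesis
    using closed_sequentially[OF closed_closure] by fastforce
qed

lemma entropy_smoothed_tendsto_0:
  "(\<lambda>k::nat. shannon_entropy q (state_mix (1 / real (k + 2)) (uniform_law q))) \<longlonglongrightarrow> 0"
proof -
  define Q where "Q = real q"
  have Q: "0 < Q" using q_pos by (simp add: Q_def)
  \<comment> \<open>The entropy with letter 0 split off from the \<open>q - 1\<close> letters of
    mass \<open>s / q\<close>; in this closed form its limit at 0 can be computed.\<close>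
  define h where "h s = - (s * ((log 2 (s / Q + (1 - s)) + (Q - 1) * log 2 (s / Q)) / Q)
    + (1 - s) * log 2 (s / Q + (1 - s)))" for s :: real
  have "shannon_entropy q (state_mix s (uniform_law q)) = h s" for s
  proof -
    let ?l = "\<lambda>x. log 2 (state_mix s (uniform_law q) x)"
    obtain r where r: "q = Suc r" using q_pos by (cases q) auto
    have "(\<Sum>x<q. 1 / real q * ?l x) = (?l 0 + (Q - 1) * log 2 (s / Q)) / Q"
      unfolding sum_distrib_left[symmetric] Q_def r
      by (subst sum.lessThan_Suc_shift) (simp add: state_mix_def delta0_def)
    then show ?thesis
      unfolding shannon_entropy_def sum_state_mix[OF q_pos] h_def
      by (simp add: state_mix_def delta0_def Q_def)
  qed
  moreover have "(\<lambda>k::nat. h (1 / real (k + 2))) \<longlonglongrightarrow> 0"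
    unfolding h_def using Q by real_asymp
  ultimately show ?thesis by simp
qed

text \<open>Serves laws whose first bound is 0, which forces \<open>lam = 1\<close>. As the uniform
  share tends to 0, the noise disappears and the second bound tends to \<open>log q\<close>.\<close>

lemma region_axis2:
  assumes lam1: "lam = 1" and b: "0 \<le> b" "b \<le> log 2 q"
  shows "(0, b) \<in> closure (convex hull inner_rates q lam)"
proof -
  let ?p = "\<lambda>k::nat. state_mix (1 / real (k + 2)) (uniform_law q)"
  \<comment> \<open>This ratio scales every \<open>b \<le> log q\<close> down to at most the second
    bound of \<open>?p k\<close>.\<close>
  let ?c = "\<lambda>k. rate_bound2 q lam (?p k) / log 2 q"
  have "(0, ?c k * b) \<in> closure (convex hull inner_rates q lam)" for k
  proof -
    have t: "0 < 1 / real (k + 2)" "1 / real (k + 2) < 1" by (simp_all add: field_simps)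
    note w = smoothed_rates_pos[OF t]
    have "0 < 1 / real (k + 2) * log 2 q" using log_q_pos by simp
    with w(2) have r1: "0 < rate_bound1 q lam (?p k)" by linarith
    have "?c k * b \<le> ?c k * log 2 q" using w(3) log_q_pos b by (intro mult_left_mono) auto
    also have "\<dots> = rate_bound2 q lam (?p k)" using log_q_pos by simp
    finally show ?thesis using w r1 b log_q_pos by (intro region_box[OF w(1)]) auto
  qed
  moreover have "(\<lambda>k. (0::real, ?c k * b)) \<longlonglongrightarrow> (0, (log 2 q - 0) / log 2 q * b)"
  proof -
    have mix1: "state_mix lam p = p" for p by (auto simp: state_mix_def lam1)
    show ?thesis
      unfolding rate_bound2_def mix1 using log_q_pos
      by (intro tendsto_Pair tendsto_mult tendsto_divide tendsto_diff tendsto_const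
          entropy_smoothed_tendsto_0) auto
  qed
  ultimately show ?thesis
    using closed_sequentially[OF closed_closure] log_q_pos by fastforce
qed

text \<open>The converse yields only domination by hull points, so everything nonnegative below them
  must lie in the closed region. Points with this property form a convex set, which reduces the
  claim to single laws.\<close>

lemma region_contains:
  assumes UW: "(U, W) \<in> convex hull rate_pairs q lam"
  shows "0 \<le> U" "0 \<le> W"
    "\<And>a b. 0 \<le> a \<Longrightarrow> a \<le> U \<Longrightarrow> 0 \<le> b \<Longrightarrow> b \<le> W \<Longrightarrow>
      (a, b) \<in> closure (convex hull inner_rates q lam)"
proof -
  let ?T = "closure (convex hull inner_rates q lam)"
  define D where "D = {z. 0 \<le> fst z \<and> 0 \<le> snd z \<and>
    (\<forall>a b. 0 \<le> a \<and> a \<le> fst z \<and> 0 \<le> b \<and> b \<le> snd z \<longrightarrow> (a, b) \<in> ?T)}"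
  have convT: "convex ?T" by (intro convex_closure convex_convex_hull)
  have "rate_pairs q lam \<subseteq> D"
  proof
    fix z assume "z \<in> rate_pairs q lam"
    then obtain p where p: "p \<in> prob_simplex q"
      and z: "z = (rate_bound1 q lam p, rate_bound2 q lam p)"
      by (auto simp: rate_pairs_def)
    note nn = rate_bounds_nonneg[OF p lam q_pos]
    have H: "0 \<le> shannon_entropy q p" "shannon_entropy q p \<le> log 2 q"
      using entropy_nonneg[OF p] entropy_le_log[OF p q_pos] by auto
    have "lam * shannon_entropy q p \<le> lam * log 2 q" using H lam by (intro mult_left_mono) auto
    then have r1: "rate_bound1 q lam p \<le> log 2 q" by (simp add: rate_bound1_def algebra_simps)
    have r2: "rate_bound2 q lam p \<le> log 2 q"
      using entropy_nonneg[OF state_mix_simplex[OF p lam q_pos]] by (simp add: rate_bound2_def)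
    have "(a, b) \<in> ?T" if ab: "0 \<le> a" "a \<le> rate_bound1 q lam p" "0 \<le> b" "b \<le> rate_bound2 q lam p" for a b
    proof -
      consider "rate_bound1 q lam p = 0" | "rate_bound2 q lam p = 0"
        | "0 < rate_bound1 q lam p" "0 < rate_bound2 q lam p"
        using nn by linarith
      then show ?thesis
      proof cases
        case 1
        have "0 \<le> lam * shannon_entropy q p" "0 \<le> (1 - lam) * log 2 q" using H lam log_q_pos by auto
        with 1 have "(1 - lam) * log 2 q = 0" unfolding rate_bound1_def by linarith
        then have "lam = 1" using log_q_pos by auto
        then show ?thesis using region_axis2[of b] ab 1 r2 by auto
      next
        case 2
        then show ?thesis using region_axis1[of a] ab r1 by auto
      next
        case 3
        then show ?thesis using region_box[OF p] ab by blast
      qed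
    qed
    with nn show "z \<in> D" unfolding D_def z by auto
  qed
  moreover have "convex D"
  proof (rule convexI)
    fix y z :: "real \<times> real" and u v :: real
    assume yz: "y \<in> D" "z \<in> D" and uv: "0 \<le> u" "0 \<le> v" "u + v = 1"
    have nn: "0 \<le> fst y" "0 \<le> snd y" "0 \<le> fst z" "0 \<le> snd z" using yz by (auto simp: D_def)
    \<comment> \<open>Scaling both end points by the same factor keeps each inside its own
      box.\<close>
    have split: "\<exists>c'. 0 \<le> c' \<and> c' \<le> 1 \<and> c = u * (c' * s) + v * (c' * t)"
      if "0 \<le> c" "c \<le> u * s + v * t" for c s t :: real
    proof (cases "c = 0")
      case True
      then show ?thesis by (intro exI[of _ 0]) simp
    next
      case False
      define r where "r = c / (u * s + v * t)"
      have "r * (u * s + v * t) = c" using False that by (simp add: r_def)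
      then have "c = u * (r * s) + v * (r * t)" by (simp add: algebra_simps)
      moreover have "0 \<le> r" "r \<le> 1" using that by (auto simp: r_def divide_le_eq_1)
      ultimately show ?thesis by blast
    qed
    have "(a, b) \<in> ?T"
      if ab: "0 \<le> a" "a \<le> u * fst y + v * fst z" "0 \<le> b" "b \<le> u * snd y + v * snd z" for a b
    proof -
      obtain a' b' where a': "0 \<le> a'" "a' \<le> 1" "a = u * (a' * fst y) + v * (a' * fst z)"
        and b': "0 \<le> b'" "b' \<le> 1" "b = u * (b' * snd y) + v * (b' * snd z)"
        using split[OF ab(1,2)] split[OF ab(3,4)] by blast
      have "(a' * fst y, b' * snd y) \<in> ?T" "(a' * fst z, b' * snd z) \<in> ?T"
        using yz a'(1,2) b'(1,2) nn by (auto simp: D_def mult_left_le_one_le)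
      then have "u *\<^sub>R (a' * fst y, b' * snd y) + v *\<^sub>R (a' * fst z, b' * snd z) \<in> ?T"
        using uv by (intro convexD[OF convT])
      then show ?thesis using a'(3) b'(3) by simp
    qed
    then show "u *\<^sub>R y + v *\<^sub>R z \<in> D" using nn uv by (auto simp: D_def)
  qed
  ultimately have "convex hull rate_pairs q lam \<subseteq> D" by (rule hull_minimal)
  with UW have "(U, W) \<in> D" by blast
  then show "0 \<le> U" "0 \<le> W"
    "\<And>a b. 0 \<le> a \<Longrightarrow> a \<le> U \<Longrightarrow> 0 \<le> b \<Longrightarrow> b \<le> W \<Longrightarrow> (a, b) \<in> ?T"
    by (auto simp: D_def)
qed

lemma achievable_in_region:
  assumes ach: "achievable q lam (R1, R2)"
  shows "(R1, R2) \<in> closure (convex hull inner_rates q lam)"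
proof -
  let ?T = "closure (convex hull inner_rates q lam)"
  have R: "0 \<le> R1" "0 \<le> R2" using ach by (auto simp: achievable_def)
  \<comment> \<open>A lower estimate of the converse bound per channel use, for error probability
    \<open>1 / (k + 1)\<close> and block length at least \<open>k + 1\<close>. The truncation at 0
    keeps the point inside the box of \<open>region_contains\<close>.\<close>
  let ?a = "\<lambda>r (k::nat). max 0 ((1 - 1 / real (k + 1)) * r - 2 / real (k + 1))"
  have "(?a R1 k, ?a R2 k) \<in> ?T" for k
  proof -
    let ?e = "1 / real (k + 1)"
    have e: "0 < ?e" "?e \<le> 1" by auto
    obtain N where N: "\<And>n. N \<le> n \<Longrightarrow> \<exists>f1 f2 g1 g2. is_code q lam n R1 R2 ?e f1 f2 g1 g2"
      using ach e(1) unfolding achievable_def by fast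
    define n where "n = max N (k + 1)"
    have n: "0 < n" "k + 1 \<le> n" "N \<le> n" by (auto simp: n_def)
    from N[OF n(3)] obtain f1 f2 g1 g2 where code: "is_code q lam n R1 R2 ?e f1 f2 g1 g2" by blast
    obtain U W :: real where UW: "(U, W) \<in> convex hull rate_pairs q lam"
      "(1 - ?e) * (n * R1 - 1) - 1 \<le> n * U" "(1 - ?e) * (n * R2 - 1) - 1 \<le> n * W"
      using code_converse[OF q_pos n(1) lam R e(2) code] by blast
    have le: "?a r k \<le> y" if "(1 - ?e) * (n * r - 1) - 1 \<le> n * y" "0 \<le> y" for r y :: real
    proof -
      have "n * ((1 - t) * r) - 2 \<le> (1 - t) * (n * r - 1) - 1" if "0 < t" for t :: real
        using that by (simp add: algebra_simps)
      from this[OF e(1)] that(1) have "n * ((1 - ?e) * r - y) \<le> 2" by (simp add: algebra_simps)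
      then have "(1 - ?e) * r - y \<le> 2 / n" using n(1) by (simp add: field_simps)
      also have "\<dots> \<le> 2 / real (k + 1)" using n by (intro divide_left_mono) auto
      finally show ?thesis using that(2) by simp
    qed
    show ?thesis
      using region_contains(1,2)[OF UW(1)]
      by (intro region_contains(3)[OF UW(1)] le[OF UW(2)] le[OF UW(3)]) auto
  qed
  moreover have "(\<lambda>k. (?a R1 k, ?a R2 k)) \<longlonglongrightarrow> (max 0 R1, max 0 R2)"
  proof -
    have "(\<lambda>k::nat. (1 - 1 / real (k + 1)) * r - 2 / real (k + 1)) \<longlonglongrightarrow> r" for r :: real
      by real_asymp
    then show ?thesis by (intro tendsto_Pair tendsto_max tendsto_const)
  qed
  ultimately show ?thesis
    using closed_sequentially[OF closed_closure] R by fastforce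
qed

end

theorem theorem4:
  fixes q :: nat and lam :: real
  assumes "q \<ge> 2" and "0 \<le> lam" and "lam \<le> 1"
  shows "capacity_region q lam =
    closure (convex hull
      {(R1, R2). 0 \<le> R1 \<and> 0 \<le> R2 \<and>
        (\<exists>p \<in> prob_simplex q.
          R1 < (1 - lam) * log 2 (real q) + lam * shannon_entropy q p \<and>
          R2 < log 2 (real q) - shannon_entropy q (\<lambda>x. lam * p x + (1 - lam) * delta0 x))})"
proof -
  have "capacity_region q lam = closure (convex hull inner_rates q lam)"
  proof (rule antisym)
    show "capacity_region q lam \<subseteq> closure (convex hull inner_rates q lam)"
      unfolding capacity_region_def
      by (rule closure_minimal) (use achievable_in_region[OF assms] in auto)
    \<comment> \<open>Hull points are achievable even before the closure is taken, because they lie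
      strictly below a point of \<open>convex hull rate_pairs q lam\<close>.\<close>
    have "convex hull inner_rates q lam \<subseteq> {R. achievable q lam R}"
    proof
      fix z assume z: "z \<in> convex hull inner_rates q lam"
      obtain a b where ab: "z = (a, b)" by (cases z)
      obtain U W where "(U, W) \<in> convex hull rate_pairs q lam" "0 \<le> a" "a < U" "0 \<le> b" "b < W"
        using hull_inner_rates_below z[unfolded ab] by blast
      then have "achievable q lam (a, b)"
        using assms by (intro achievable_below_hull[of q lam U W]) auto
      then show "z \<in> {R. achievable q lam R}" by (simp add: ab)
    qed
    then show "closure (convex hull inner_rates q lam) \<subseteq> capacity_region q lam"
      unfolding capacity_region_def by (rule closure_mono)
  qed
  then show ?thesis
    by (simp add: inner_rates_def rate_bound1_def rate_bound2_def state_mix_def)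
qed

end
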